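(* Let $A$ be a complex Banach space, let $\varphi\in A^*$ be non-zero with $\|\varphi\|\le 1$, and let ${}_\varphi A$ denote $A$ with the Banach algebra product $a\cdot b=\langle\varphi,a\rangle b$. Then: (i) ${}_\varphi A$ is Arens regular and $({}_\varphi A)^{**}={}_\varphi(A^{**})$ (where on the right $\varphi$ is regarded as an element of $A^{***}$). Furthermore, for each $n\in\mathbb{N}$, $({}_\varphi A)^{(2n)}$ is Arens regular. (ii) $({}_\varphi A)^{**}\cdot{}_\varphi A={}_\varphi A$ and ${}_\varphi A\cdot({}_\varphi A)^{**}=({}_\varphi A)^{**}$; in particular, ${}_\varphi A$ is a left ideal of $({}_\varphi A)^{**}$. (iii) $({}_\varphi A)^{*}\cdot{}_\varphi A=({}_\varphi A)^{*}$ and ${}_\varphi A\cdot({}_\varphi A)^{*}=\mathbb{C}\varphi$.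
   Context: Elements of a space are identified with their canonical images in its second dual. For a Banach algebra $B$, with $a,b\in B$, $f\in B^*$, $m,n\in B^{**}$, define $\langle f\cdot a,b\rangle=\langle f,ab\rangle$, $\langle a\cdot f,b\rangle=\langle f,ba\rangle$, $\langle n\cdot f,a\rangle=\langle n,f\cdot a\rangle$, $\langle f\cdot n,a\rangle=\langle n,a\cdot f\rangle$. The two Arens products on $B^{**}$ are $\langle m\square n,f\rangle=\langle m,n\cdot f\rangle$ and $\langle m\lozenge n,f\rangle=\langle n,f\cdot m\rangle$. $B$ is Arens regular if $\square$ and $\lozenge$ coincide on $B^{**}$. $B^{(k)}$ denotes the $k$-th dual of $B$; the even duals $B^{(2n)}$ are Banach algebras under the (iterated) Arens product, starting from $B^{**}$ with $\square$. The equality $({}_\varphi A)^{**}={}_\varphi(A^{**})$ means equality as Banach algebras. For subsets $X,Y$, $X\cdot Y$ denotes the set of products $\{x\cdot y: x\in X,y\in Y\}$; the actions of $B$ on $B^*$ are $f\cdot a$ and $a\cdot f$ given by $\langle f\cdot a,b\rangle=\langle f,ab\rangle$ and $\langle a\cdot f,b\rangle=\langle f,ba\rangle$ for $a,b\in B$, $f\in B^*$, and those on $B^{**}$ are given by the Arens product with elements of $B\subseteq B^{**}$. *)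

theory Defs
  imports
    "HOL-Analysis.Abstract_Metric_Spaces"
    "HOL-Algebra.Coset"
    "HOL-Algebra.Module"
begin

section \<open>Complex Banach spaces and Banach algebras\<close>

definition complex_ring :: "complex ring" where
  "complex_ring =
     \<lparr>carrier = UNIV, monoid.mult = (*), monoid.one = 1, ring.zero = 0, ring.add = (+)\<rparr>"

text \<open>As usual for HOL-Algebra modules, the fields \<open>mult\<close> and \<open>one\<close> play no role in a space;
  \<open>mult\<close> is the product when the structure is regarded as an algebra. Algebras are not assumed
  to be unital, so \<open>one\<close> is never used.\<close>

record 'a normed_module = "(complex, 'a) module" +
  vnorm :: "'a \<Rightarrow> real"

locale complex_normed_space =
  module complex_ring V for V :: "('a, 'm) normed_module_scheme" (structure) +
  assumes vnorm_eq_0_iff: "x \<in> carrier V \<Longrightarrow> vnorm V x = 0 \<longleftrightarrow> x = \<zero>"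
    and vnorm_triangle:
      "\<lbrakk>x \<in> carrier V; y \<in> carrier V\<rbrakk> \<Longrightarrow> vnorm V (x \<oplus> y) \<le> vnorm V x + vnorm V y"
    and vnorm_smult: "x \<in> carrier V \<Longrightarrow> vnorm V (c \<odot> x) = cmod c * vnorm V x"

text \<open>The library's \<open>Metric_space\<close> wants a distance that is symmetric and non-negative
  on the whole type, hence the guard.\<close>

definition vdist :: "('a, 'm) normed_module_scheme \<Rightarrow> 'a \<Rightarrow> 'a \<Rightarrow> real" where
  "vdist V x y = (if x \<in> carrier V \<and> y \<in> carrier V then vnorm V (x \<ominus>\<^bsub>V\<^esub> y) else 0)"

locale complex_banach_space = complex_normed_space +
  assumes complete: "Metric_space.mcomplete (carrier V) (vdist V)"

locale complex_banach_algebra = complex_banach_space V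
  for V :: "('a, 'm) normed_module_scheme" (structure) +
  assumes mult_closed: "\<lbrakk>x \<in> carrier V; y \<in> carrier V\<rbrakk> \<Longrightarrow> x \<otimes> y \<in> carrier V"
    and mult_assoc: "\<lbrakk>x \<in> carrier V; y \<in> carrier V; z \<in> carrier V\<rbrakk>
      \<Longrightarrow> (x \<otimes> y) \<otimes> z = x \<otimes> (y \<otimes> z)"
    and mult_add_left: "\<lbrakk>x \<in> carrier V; y \<in> carrier V; z \<in> carrier V\<rbrakk>
      \<Longrightarrow> (x \<oplus> y) \<otimes> z = (x \<otimes> z) \<oplus> (y \<otimes> z)"
    and mult_add_right: "\<lbrakk>x \<in> carrier V; y \<in> carrier V; z \<in> carrier V\<rbrakk>
      \<Longrightarrow> x \<otimes> (y \<oplus> z) = (x \<otimes> y) \<oplus> (x \<otimes> z)"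
    and mult_smult_left: "\<lbrakk>x \<in> carrier V; y \<in> carrier V\<rbrakk> \<Longrightarrow> (c \<odot> x) \<otimes> y = c \<odot> (x \<otimes> y)"
    and mult_smult_right: "\<lbrakk>x \<in> carrier V; y \<in> carrier V\<rbrakk> \<Longrightarrow> x \<otimes> (c \<odot> y) = c \<odot> (x \<otimes> y)"
    and vnorm_mult: "\<lbrakk>x \<in> carrier V; y \<in> carrier V\<rbrakk>
      \<Longrightarrow> vnorm V (x \<otimes> y) \<le> vnorm V x * vnorm V y"

definition left_ideal :: "'a set \<Rightarrow> ('a, 'm) normed_module_scheme \<Rightarrow> bool" where
  "left_ideal I B \<longleftrightarrow> submodule I complex_ring B \<and> (\<forall>b\<in>carrier B. \<forall>x\<in>I. b \<otimes>\<^bsub>B\<^esub> x \<in> I)"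


section \<open>Duals\<close>

text \<open>Functionals are extensional (\<open>undefined\<close> outside the space), so that equality of
  functionals is equality of HOL functions.\<close>

definition dual :: "('a, 'm) normed_module_scheme \<Rightarrow> ('a \<Rightarrow> complex) normed_module" where
  "dual V = \<lparr>
     carrier = {f \<in> extensional (carrier V).
       (\<forall>x\<in>carrier V. \<forall>y\<in>carrier V. f (x \<oplus>\<^bsub>V\<^esub> y) = f x + f y) \<and>
       (\<forall>c. \<forall>x\<in>carrier V. f (c \<odot>\<^bsub>V\<^esub> x) = c * f x) \<and>
       (\<exists>K. \<forall>x\<in>carrier V. cmod (f x) \<le> K * vnorm V x)},
     monoid.mult = undefined,
     monoid.one = undefined,
     zero = (\<lambda>x\<in>carrier V. 0),
     add = (\<lambda>f g. \<lambda>x\<in>carrier V. f x + g x),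
     module.smult = (\<lambda>c f. \<lambda>x\<in>carrier V. c * f x),
     vnorm = (\<lambda>f. SUP x\<in>{x \<in> carrier V. vnorm V x \<le> 1}. cmod (f x))\<rparr>"

definition canon :: "('a, 'm) normed_module_scheme \<Rightarrow> 'a \<Rightarrow> ('a \<Rightarrow> complex) \<Rightarrow> complex" where
  "canon V x = (\<lambda>f\<in>carrier (dual V). f x)"


section \<open>Module actions and Arens products\<close>

text \<open>In the names, \<open>act_fa\<close> is \<open>f \<cdot> a\<close>, \<open>act_af\<close> is \<open>a \<cdot> f\<close>, \<open>act_nf\<close> is \<open>n \<cdot> f\<close>
  and \<open>act_fn\<close> is \<open>f \<cdot> n\<close>, for \<open>a\<close> in the algebra, \<open>f\<close> in its dual and \<open>n\<close> in its bidual.\<close>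

definition act_fa ::
  "('a, 'm) normed_module_scheme \<Rightarrow> ('a \<Rightarrow> complex) \<Rightarrow> 'a \<Rightarrow> 'a \<Rightarrow> complex" where
  "act_fa B f a = (\<lambda>b\<in>carrier B. f (a \<otimes>\<^bsub>B\<^esub> b))"

definition act_af ::
  "('a, 'm) normed_module_scheme \<Rightarrow> 'a \<Rightarrow> ('a \<Rightarrow> complex) \<Rightarrow> 'a \<Rightarrow> complex" where
  "act_af B a f = (\<lambda>b\<in>carrier B. f (b \<otimes>\<^bsub>B\<^esub> a))"

definition act_nf :: "('a, 'm) normed_module_scheme \<Rightarrow> (('a \<Rightarrow> complex) \<Rightarrow> complex)
    \<Rightarrow> ('a \<Rightarrow> complex) \<Rightarrow> 'a \<Rightarrow> complex" where
  "act_nf B n f = (\<lambda>a\<in>carrier B. n (act_fa B f a))"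

definition act_fn :: "('a, 'm) normed_module_scheme \<Rightarrow> ('a \<Rightarrow> complex)
    \<Rightarrow> (('a \<Rightarrow> complex) \<Rightarrow> complex) \<Rightarrow> 'a \<Rightarrow> complex" where
  "act_fn B f n = (\<lambda>a\<in>carrier B. n (act_af B a f))"

definition arens_box :: "('a, 'm) normed_module_scheme \<Rightarrow> (('a \<Rightarrow> complex) \<Rightarrow> complex)
    \<Rightarrow> (('a \<Rightarrow> complex) \<Rightarrow> complex) \<Rightarrow> ('a \<Rightarrow> complex) \<Rightarrow> complex" where
  "arens_box B m n = (\<lambda>f\<in>carrier (dual B). m (act_nf B n f))"

definition arens_diamond :: "('a, 'm) normed_module_scheme \<Rightarrow> (('a \<Rightarrow> complex) \<Rightarrow> complex)
    \<Rightarrow> (('a \<Rightarrow> complex) \<Rightarrow> complex) \<Rightarrow> ('a \<Rightarrow> complex) \<Rightarrow> complex" where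
  "arens_diamond B m n = (\<lambda>f\<in>carrier (dual B). n (act_fn B f m))"

definition arens_regular :: "('a, 'm) normed_module_scheme \<Rightarrow> bool" where
  "arens_regular B \<longleftrightarrow>
     (\<forall>m\<in>carrier (dual (dual B)). \<forall>n\<in>carrier (dual (dual B)).
        arens_box B m n = arens_diamond B m n)"

text \<open>Products are made extensional so that two Banach algebras with the same underlying Banach
  space and the same product are equal as records.\<close>

definition bidual_algebra ::
  "('a, 'm) normed_module_scheme \<Rightarrow> (('a \<Rightarrow> complex) \<Rightarrow> complex) normed_module" where
  "bidual_algebra B = (dual (dual B))\<lparr>monoid.mult :=
     (\<lambda>m\<in>carrier (dual (dual B)). \<lambda>n\<in>carrier (dual (dual B)). arens_box B m n)\<rparr>"

definition phi_algebra :: "('a \<Rightarrow> complex) \<Rightarrow> 'a normed_module \<Rightarrow> 'a normed_module" where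
  "phi_algebra \<phi> A = A\<lparr>monoid.mult := (\<lambda>a\<in>carrier A. \<lambda>b\<in>carrier A. \<phi> a \<odot>\<^bsub>A\<^esub> b)\<rparr>"


section \<open>Iterated even duals\<close>

definition isometric_iso ::
  "('a \<Rightarrow> 'b) \<Rightarrow> ('a, 'm) normed_module_scheme \<Rightarrow> ('b, 'k) normed_module_scheme \<Rightarrow> bool" where
  "isometric_iso h V W \<longleftrightarrow>
     bij_betw h (carrier V) (carrier W) \<and>
     (\<forall>x\<in>carrier V. \<forall>y\<in>carrier V. h (x \<oplus>\<^bsub>V\<^esub> y) = h x \<oplus>\<^bsub>W\<^esub> h y) \<and>
     (\<forall>c. \<forall>x\<in>carrier V. h (c \<odot>\<^bsub>V\<^esub> x) = c \<odot>\<^bsub>W\<^esub> h x) \<and>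
     (\<forall>x\<in>carrier V. vnorm W (h x) = vnorm V x)"

definition isometric_algebra_iso ::
  "('a \<Rightarrow> 'b) \<Rightarrow> ('a, 'm) normed_module_scheme \<Rightarrow> ('b, 'k) normed_module_scheme \<Rightarrow> bool" where
  "isometric_algebra_iso h B C \<longleftrightarrow>
     isometric_iso h B C \<and>
     (\<forall>x\<in>carrier B. \<forall>y\<in>carrier B. h (x \<otimes>\<^bsub>B\<^esub> y) = h x \<otimes>\<^bsub>C\<^esub> h y)"

text \<open>The literal \<open>2n\<close>-th dual of a structure over \<open>'a\<close> lives in a type that depends on \<open>n\<close>,
  so a statement about all \<open>n\<close> needs copies of the even duals inside one type \<open>'u\<close>:
  \<open>even_dual B n C\<close> says that the Banach algebra \<open>C\<close> over \<open>'u\<close> is (an isometrically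
  isomorphic copy of) \<open>B\<^sup>(\<^sup>2\<^sup>n\<^sup>)\<close>, each bidual carrying the product \<open>arens_box\<close> of the
  previous even dual. For every \<open>n\<close> this is inhabited when \<open>'u\<close> is large enough: see
  \<open>even_dual_0\<close> and \<open>even_dual_bidual_algebra\<close> below, by which the literal iterates
  \<open>B\<close>, \<open>bidual_algebra B\<close>, \<open>bidual_algebra (bidual_algebra B)\<close> and so on are covered.\<close>

inductive even_dual :: "'a normed_module \<Rightarrow> nat \<Rightarrow> 'u normed_module \<Rightarrow> bool"
  for B :: "'a normed_module" where
  zero: "\<lbrakk>complex_banach_algebra C; isometric_algebra_iso h C B\<rbrakk> \<Longrightarrow> even_dual B 0 C"
| Suc: "\<lbrakk>even_dual B n C; complex_banach_algebra D; isometric_algebra_iso h D (bidual_algebra C)\<rbrakk>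
    \<Longrightarrow> even_dual B (Suc n) D"


section \<open>Basic facts\<close>

lemma complex_ring_simps [simp]:
  "carrier complex_ring = UNIV" "x \<oplus>\<^bsub>complex_ring\<^esub> y = x + y" "x \<otimes>\<^bsub>complex_ring\<^esub> y = x * y"
  "\<zero>\<^bsub>complex_ring\<^esub> = 0" "\<one>\<^bsub>complex_ring\<^esub> = 1"
  by (simp_all add: complex_ring_def)

lemma cring_complex_ring: "cring complex_ring"
proof (rule cringI)
  show "abelian_group complex_ring"
  proof (rule abelian_groupI)
    fix x :: complex
    show "\<exists>y\<in>carrier complex_ring. y \<oplus>\<^bsub>complex_ring\<^esub> x = \<zero>\<^bsub>complex_ring\<^esub>"
      by (rule bexI[of _ "- x"]) simp_all
  qed simp_all
  show "comm_monoid complex_ring"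
    by (rule comm_monoidI) simp_all
qed (simp add: distrib_right)

lemma complex_ring_uminus [simp]: "\<ominus>\<^bsub>complex_ring\<^esub> x = - x"
proof -
  interpret cring complex_ring by (rule cring_complex_ring)
  show ?thesis
    by (rule minus_equality) simp_all
qed

context complex_normed_space
begin

lemma smult_closed_complex [simp, intro]: "x \<in> carrier V \<Longrightarrow> c \<odot> x \<in> carrier V"
  using smult_closed by simp

lemma minus_eq_smult: 
  assumes "x \<in> carrier V" "y \<in> carrier V"
  shows "x \<ominus>\<^bsub>V\<^esub> y = x \<oplus>\<^bsub>V\<^esub> ((-1) \<odot>\<^bsub>V\<^esub> y)"
  using smult_l_minus[of 1 y] smult_one[of y] assms by (simp add: a_minus_def)

lemma vnorm_zero [simp]: "vnorm V \<zero>\<^bsub>V\<^esub> = 0"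
  by (simp add: vnorm_eq_0_iff)

lemma vnorm_minus: "x \<in> carrier V \<Longrightarrow> y \<in> carrier V \<Longrightarrow> vnorm V (x \<ominus>\<^bsub>V\<^esub> y) = vnorm V (y \<ominus>\<^bsub>V\<^esub> x)"
proof -
  assume xy: "x \<in> carrier V" "y \<in> carrier V"
  have "y \<ominus>\<^bsub>V\<^esub> x = (-1) \<odot>\<^bsub>V\<^esub> (x \<ominus>\<^bsub>V\<^esub> y)"
    using xy smult_r_distr[of "-1" x "(-1) \<odot>\<^bsub>V\<^esub> y"] smult_assoc1[of "-1" "-1" y] smult_one[of y]
    by (simp add: minus_eq_smult M.a_comm)
  then show ?thesis
    using vnorm_smult[of "x \<ominus>\<^bsub>V\<^esub> y" "-1"] xy by simp
qed

lemma vnorm_nonneg: assumes "x \<in> carrier V" shows "0 \<le> vnorm V x"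
proof -
  have "vnorm V (x \<oplus>\<^bsub>V\<^esub> (-1) \<odot>\<^bsub>V\<^esub> x) \<le> vnorm V x + vnorm V ((-1) \<odot>\<^bsub>V\<^esub> x)"
    using assms by (intro vnorm_triangle) auto
  moreover have "x \<oplus>\<^bsub>V\<^esub> (-1) \<odot>\<^bsub>V\<^esub> x = \<zero>\<^bsub>V\<^esub>"
    using assms minus_eq_smult[of x x] by (simp add: a_minus_def M.r_neg)
  ultimately show ?thesis using assms by (simp add: vnorm_smult)
qed

lemma Metric_space_vdist: "Metric_space (carrier V) (vdist V)"
proof
  show "0 \<le> vdist V x y" for x y by (simp add: vdist_def vnorm_nonneg)
  show "vdist V x y = vdist V y x" for x y by (auto simp: vdist_def vnorm_minus)
  show "vdist V x y = 0 \<longleftrightarrow> x = y" if "x \<in> carrier V" "y \<in> carrier V" for x y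
  proof -
    have "x = (x \<ominus>\<^bsub>V\<^esub> y) \<oplus>\<^bsub>V\<^esub> y"
      using that by (simp add: a_minus_def M.a_assoc M.l_neg)
    then show ?thesis
      using that by (auto simp: vdist_def vnorm_eq_0_iff a_minus_def M.r_neg)
  qed
  show "vdist V x z \<le> vdist V x y + vdist V y z"
    if "x \<in> carrier V" "y \<in> carrier V" "z \<in> carrier V" for x y z
  proof -
    have "x \<ominus>\<^bsub>V\<^esub> z = (x \<ominus>\<^bsub>V\<^esub> y) \<oplus>\<^bsub>V\<^esub> (y \<ominus>\<^bsub>V\<^esub> z)"
      using that by (simp add: a_minus_def M.a_assoc M.r_neg1)
    then show ?thesis using that vnorm_triangle[of "x \<ominus>\<^bsub>V\<^esub> y" "y \<ominus>\<^bsub>V\<^esub> z"] by (auto simp: vdist_def)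
  qed
qed

lemma mcomplete_iff:
  "Metric_space.mcomplete (carrier V) (vdist V) \<longleftrightarrow>
   (\<forall>\<sigma>::nat \<Rightarrow> 'a. range \<sigma> \<subseteq> carrier V \<longrightarrow>
      (\<forall>e>0. \<exists>N. \<forall>m\<ge>N. \<forall>n\<ge>N. vnorm V (\<sigma> m \<ominus>\<^bsub>V\<^esub> \<sigma> n) < e) \<longrightarrow>
      (\<exists>x\<in>carrier V. \<forall>e>0. \<exists>N. \<forall>n\<ge>N. vnorm V (\<sigma> n \<ominus>\<^bsub>V\<^esub> x) < e))"
proof -
  interpret Metric_space "carrier V" "vdist V" by (rule Metric_space_vdist)
  have 1: "MCauchy \<sigma> \<longleftrightarrow> range \<sigma> \<subseteq> carrier V \<and>
      (\<forall>e>0. \<exists>N. \<forall>m\<ge>N. \<forall>n\<ge>N. vnorm V (\<sigma> m \<ominus>\<^bsub>V\<^esub> \<sigma> n) < e)" for \<sigma> :: "nat \<Rightarrow> 'a"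
    by (auto simp: MCauchy_def vdist_def image_subset_iff)
  have 2: "limitin mtopology \<sigma> x sequentially \<longleftrightarrow> x \<in> carrier V \<and>
      (\<forall>e>0. \<exists>N. \<forall>n\<ge>N. vnorm V (\<sigma> n \<ominus>\<^bsub>V\<^esub> x) < e)" if "range \<sigma> \<subseteq> carrier V"
    for \<sigma> :: "nat \<Rightarrow> 'a" and x
  proof -
    have "\<sigma> n \<in> carrier V" for n using that by blast
    then show ?thesis unfolding limit_metric_sequentially by (auto simp: vdist_def)
  qed
  show ?thesis
    unfolding mcomplete_def
  proof (intro iff_allI)
    fix \<sigma> :: "nat \<Rightarrow> 'a"
    show "(MCauchy \<sigma> \<longrightarrow> (\<exists>x. limitin mtopology \<sigma> x sequentially)) \<longleftrightarrow>
      (range \<sigma> \<subseteq> carrier V \<longrightarrow>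
      (\<forall>e>0. \<exists>N. \<forall>m\<ge>N. \<forall>n\<ge>N. vnorm V (\<sigma> m \<ominus>\<^bsub>V\<^esub> \<sigma> n) < e) \<longrightarrow>
      (\<exists>x\<in>carrier V. \<forall>e>0. \<exists>N. \<forall>n\<ge>N. vnorm V (\<sigma> n \<ominus>\<^bsub>V\<^esub> x) < e))"
    proof (cases "range \<sigma> \<subseteq> carrier V")
      case True
      then show ?thesis unfolding 1 2[OF True] Bex_def by simp
    next
      case False
      then show ?thesis by (simp add: 1)
    qed
  qed
qed

end


subsection \<open>The dual of a normed space is a Banach space\<close>

lemma dual_simps:
  "\<zero>\<^bsub>dual V\<^esub> = (\<lambda>x\<in>carrier V. 0)"
  "f \<oplus>\<^bsub>dual V\<^esub> g = (\<lambda>x\<in>carrier V. f x + g x)"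
  "c \<odot>\<^bsub>dual V\<^esub> f = (\<lambda>x\<in>carrier V. c * f x)"
  by (simp_all add: dual_def)

lemma dual_vnorm: "vnorm (dual V) f = (SUP x\<in>{x \<in> carrier V. vnorm V x \<le> 1}. cmod (f x))"
  by (simp add: dual_def)

lemma in_dual_iff: "f \<in> carrier (dual V) \<longleftrightarrow> f \<in> extensional (carrier V) \<and>
       (\<forall>x\<in>carrier V. \<forall>y\<in>carrier V. f (x \<oplus>\<^bsub>V\<^esub> y) = f x + f y) \<and>
       (\<forall>c. \<forall>x\<in>carrier V. f (c \<odot>\<^bsub>V\<^esub> x) = c * f x) \<and>
       (\<exists>K. \<forall>x\<in>carrier V. cmod (f x) \<le> K * vnorm V x)"
  by (simp add: dual_def)

lemma dual_eqI:
  "\<lbrakk>f \<in> extensional (carrier V); g \<in> extensional (carrier V); \<And>x. x \<in> carrier V \<Longrightarrow> f x = g x\<rbrakk>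
   \<Longrightarrow> f = g"
  by (rule extensionalityI)

lemma dual_add: "\<lbrakk>f \<in> carrier (dual V); x \<in> carrier V; y \<in> carrier V\<rbrakk> \<Longrightarrow> f (x \<oplus>\<^bsub>V\<^esub> y) = f x + f y"
  and dual_smult: "\<lbrakk>f \<in> carrier (dual V); x \<in> carrier V\<rbrakk> \<Longrightarrow> f (c \<odot>\<^bsub>V\<^esub> x) = c * f x"
  and dual_ext: "f \<in> carrier (dual V) \<Longrightarrow> f \<in> extensional (carrier V)"
  by (simp_all add: in_dual_iff)

context complex_normed_space
begin

lemma dual_bound: assumes f: "f \<in> carrier (dual V)" and x: "x \<in> carrier V"
  shows "cmod (f x) \<le> vnorm (dual V) f * vnorm V x"
proof -
  obtain K where K: "\<And>x. x \<in> carrier V \<Longrightarrow> cmod (f x) \<le> K * vnorm V x"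
    using f unfolding in_dual_iff by blast
  show ?thesis
  proof (cases "x = \<zero>\<^bsub>V\<^esub>")
    case True
    then show ?thesis using K[OF x] by simp
  next
    case False
    with x have pos: "vnorm V x > 0" using vnorm_nonneg[OF x] vnorm_eq_0_iff[OF x] by linarith
    define y where "y = complex_of_real (1 / vnorm V x) \<odot>\<^bsub>V\<^esub> x"
    have y: "y \<in> carrier V" "vnorm V y \<le> 1" using x pos by (auto simp: y_def vnorm_smult norm_divide)
    have "cmod (f z) \<le> \<bar>K\<bar>" if "z \<in> carrier V" "vnorm V z \<le> 1" for z
    proof -
      have "K * vnorm V z \<le> \<bar>K\<bar> * 1"
        using that vnorm_nonneg[of z] by (intro mult_mono) auto
      then show ?thesis using K[of z] that by simp
    qed
    then have "bdd_above ((\<lambda>x. cmod (f x)) ` {x \<in> carrier V. vnorm V x \<le> 1})"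
      by (intro bdd_aboveI[of _ "\<bar>K\<bar>"]) auto
    then have "cmod (f y) \<le> vnorm (dual V) f"
      unfolding dual_vnorm using y by (intro cSUP_upper) auto
    moreover have "f y = complex_of_real (1 / vnorm V x) * f x"
      unfolding y_def using f x by (rule dual_smult)
    ultimately show ?thesis using pos by (simp add: norm_mult norm_divide field_simps)
  qed
qed

lemma dual_vnorm_le:
  assumes "0 \<le> K" "\<And>x. x \<in> carrier V \<Longrightarrow> cmod (f x) \<le> K * vnorm V x"
  shows "vnorm (dual V) f \<le> K"
  unfolding dual_vnorm
proof (rule cSUP_least)
  show "{x \<in> carrier V. vnorm V x \<le> 1} \<noteq> {}" using vnorm_zero M.zero_closed by force
  fix x assume x: "x \<in> {x \<in> carrier V. vnorm V x \<le> 1}"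
  then have "K * vnorm V x \<le> K * 1" using assms(1) by (intro mult_left_mono) auto
  then show "cmod (f x) \<le> K" using assms(2)[of x] x by simp
qed

lemma dual_vnorm_nonneg: "f \<in> carrier (dual V) \<Longrightarrow> 0 \<le> vnorm (dual V) f"
proof -
  assume f: "f \<in> carrier (dual V)"
  obtain K where K: "\<And>x. x \<in> carrier V \<Longrightarrow> cmod (f x) \<le> K * vnorm V x"
    using f unfolding in_dual_iff by blast
  have "cmod (f \<zero>\<^bsub>V\<^esub>) \<le> vnorm (dual V) f"
    unfolding dual_vnorm
  proof (rule cSUP_upper)
    show "bdd_above ((\<lambda>x. cmod (f x)) ` {x \<in> carrier V. vnorm V x \<le> 1})"
    proof (rule bdd_aboveI[of _ "\<bar>K\<bar>"], clarify)
      fix z assume z: "z \<in> carrier V" "vnorm V z \<le> 1"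
      have "K * vnorm V z \<le> \<bar>K\<bar> * 1"
        using z vnorm_nonneg[of z] by (intro mult_mono) auto
      then show "cmod (f z) \<le> \<bar>K\<bar>" using K[of z] z by simp
    qed
  qed simp
  then show ?thesis using norm_ge_zero order_trans by blast
qed

lemma dualI:
  assumes "f \<in> extensional (carrier V)"
    and "\<And>x y. \<lbrakk>x \<in> carrier V; y \<in> carrier V\<rbrakk> \<Longrightarrow> f (x \<oplus>\<^bsub>V\<^esub> y) = f x + f y"
    and "\<And>c x. x \<in> carrier V \<Longrightarrow> f (c \<odot>\<^bsub>V\<^esub> x) = c * f x"
    and "\<And>x. x \<in> carrier V \<Longrightarrow> cmod (f x) \<le> K * vnorm V x"
  shows "f \<in> carrier (dual V)"
  unfolding in_dual_iff using assms by blast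

lemma dual_zero_closed: "\<zero>\<^bsub>dual V\<^esub> \<in> carrier (dual V)"
  by (rule dualI[of _ 0]) (auto simp: dual_simps)

lemma dual_add_closed:
  assumes "f \<in> carrier (dual V)" "g \<in> carrier (dual V)"
  shows "f \<oplus>\<^bsub>dual V\<^esub> g \<in> carrier (dual V)"
proof (rule dualI[of _ "vnorm (dual V) f + vnorm (dual V) g"])
  fix x assume x: "x \<in> carrier V"
  show "cmod ((f \<oplus>\<^bsub>dual V\<^esub> g) x) \<le> (vnorm (dual V) f + vnorm (dual V) g) * vnorm V x"
    using norm_triangle_ineq[of "f x" "g x"] dual_bound[OF assms(1) x] dual_bound[OF assms(2) x] x
    by (simp add: dual_simps distrib_right)
qed (use assms in \<open>auto simp: dual_simps dual_add dual_smult algebra_simps\<close>)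

lemma dual_smult_closed:
  assumes "f \<in> carrier (dual V)"
  shows "c \<odot>\<^bsub>dual V\<^esub> f \<in> carrier (dual V)"
proof (rule dualI[of _ "cmod c * vnorm (dual V) f"])
  fix x assume x: "x \<in> carrier V"
  show "cmod ((c \<odot>\<^bsub>dual V\<^esub> f) x) \<le> (cmod c * vnorm (dual V) f) * vnorm V x"
    using mult_left_mono[OF dual_bound[OF assms(1) x], of "cmod c"] x
    by (simp add: dual_simps norm_mult mult.assoc)
qed (use assms in \<open>auto simp: dual_simps dual_add dual_smult algebra_simps\<close>)

lemma abelian_group_dual: "abelian_group (dual V)"
proof (rule abelian_groupI)
  fix f assume f: "f \<in> carrier (dual V)"
  show "\<exists>g\<in>carrier (dual V). g \<oplus>\<^bsub>dual V\<^esub> f = \<zero>\<^bsub>dual V\<^esub>"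
    by (rule bexI[of _ "(-1) \<odot>\<^bsub>dual V\<^esub> f"]) (simp_all only: dual_smult_closed f, auto simp: dual_simps)
  show "\<zero>\<^bsub>dual V\<^esub> \<oplus>\<^bsub>dual V\<^esub> f = f"
    using dual_ext[OF f] by (auto simp: dual_simps extensional_def)
qed (auto simp: dual_zero_closed dual_add_closed, auto simp: dual_simps algebra_simps)

lemma module_dual: "module complex_ring (dual V)"
proof (rule moduleI)
  fix f assume f: "f \<in> carrier (dual V)"
  show "\<one>\<^bsub>complex_ring\<^esub> \<odot>\<^bsub>dual V\<^esub> f = f"
    using extensional_restrict[OF dual_ext[OF f]] by (simp add: dual_simps)
qed (auto simp: cring_complex_ring abelian_group_dual dual_smult_closed,
     auto simp: dual_simps algebra_simps)

lemma complex_normed_space_dual: "complex_normed_space (dual V)"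
  unfolding complex_normed_space_def complex_normed_space_axioms_def
proof (intro conjI allI impI module_dual)
  fix f g c assume f: "f \<in> carrier (dual V)"
  show "(vnorm (dual V) f = 0) = (f = \<zero>\<^bsub>dual V\<^esub>)"
  proof
    assume 0: "vnorm (dual V) f = 0"
    show "f = \<zero>\<^bsub>dual V\<^esub>"
    proof (rule dual_eqI)
      show "f x = \<zero>\<^bsub>dual V\<^esub> x" if "x \<in> carrier V" for x
        using dual_bound[OF f that] 0 that by (simp add: dual_simps)
    qed (use f dual_zero_closed dual_ext in auto)
  next
    assume "f = \<zero>\<^bsub>dual V\<^esub>"
    then have "vnorm (dual V) f \<le> 0" by (intro dual_vnorm_le) (auto simp: dual_simps)
    then show "vnorm (dual V) f = 0" using dual_vnorm_nonneg[OF f] by simp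
  qed
  have le: "vnorm (dual V) (c \<odot>\<^bsub>dual V\<^esub> h) \<le> cmod c * vnorm (dual V) h"
    if h: "h \<in> carrier (dual V)" for h c
  proof (rule dual_vnorm_le)
    show "cmod ((c \<odot>\<^bsub>dual V\<^esub> h) x) \<le> cmod c * vnorm (dual V) h * vnorm V x"
      if x: "x \<in> carrier V" for x
      using mult_left_mono[OF dual_bound[OF h x], of "cmod c"] x
      by (simp add: dual_simps norm_mult mult.assoc)
  qed (simp add: dual_vnorm_nonneg h)
  show "vnorm (dual V) (c \<odot>\<^bsub>dual V\<^esub> f) = cmod c * vnorm (dual V) f"
  proof (cases "c = 0")
    case True
    then show ?thesis using le[OF f, of c] dual_vnorm_nonneg[OF dual_smult_closed[OF f, of c]] by simp
  next
    case False
    have "(1/c) \<odot>\<^bsub>dual V\<^esub> (c \<odot>\<^bsub>dual V\<^esub> f) = f"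
      using False dual_ext[OF f] by (auto simp: dual_simps extensional_def)
    then have "vnorm (dual V) f \<le> cmod (1/c) * vnorm (dual V) (c \<odot>\<^bsub>dual V\<^esub> f)"
      using le[OF dual_smult_closed[OF f, of c], of "1/c"] by simp
    then show ?thesis using le[OF f, of c] False by (simp add: norm_divide field_simps)
  qed
  assume g: "g \<in> carrier (dual V)"
  show "vnorm (dual V) (f \<oplus>\<^bsub>dual V\<^esub> g) \<le> vnorm (dual V) f + vnorm (dual V) g"
  proof (rule dual_vnorm_le)
    show "cmod ((f \<oplus>\<^bsub>dual V\<^esub> g) x) \<le> (vnorm (dual V) f + vnorm (dual V) g) * vnorm V x"
      if x: "x \<in> carrier V" for x
      using norm_triangle_ineq[of "f x" "g x"] dual_bound[OF f x] dual_bound[OF g x] x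
      by (simp add: dual_simps distrib_right)
  qed (simp add: dual_vnorm_nonneg f g)
qed

lemma dual_minus: 
  assumes "f \<in> carrier (dual V)" "g \<in> carrier (dual V)"
  shows "f \<ominus>\<^bsub>dual V\<^esub> g = (\<lambda>x\<in>carrier V. f x - g x)"
proof -
  interpret D: complex_normed_space "dual V" by (rule complex_normed_space_dual)
  show ?thesis using D.minus_eq_smult[OF assms] by (auto simp: dual_simps)
qed

lemma complex_banach_space_dual: "complex_banach_space (dual V)"
proof -
  interpret D: complex_normed_space "dual V" by (rule complex_normed_space_dual)
  have "\<exists>g\<in>carrier (dual V). \<forall>e>0. \<exists>N. \<forall>n\<ge>N. vnorm (dual V) (\<sigma> n \<ominus>\<^bsub>dual V\<^esub> g) < e"
    if \<sigma>: "range \<sigma> \<subseteq> carrier (dual V)"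
      and Cau: "\<forall>e>0. \<exists>N. \<forall>m\<ge>N. \<forall>n\<ge>N. vnorm (dual V) (\<sigma> m \<ominus>\<^bsub>dual V\<^esub> \<sigma> n) < e"
    for \<sigma> :: "nat \<Rightarrow> 'a \<Rightarrow> complex"
  proof -
    have s: "\<sigma> n \<in> carrier (dual V)" for n using \<sigma> by blast
    have diff: "cmod (\<sigma> m x - \<sigma> n x) \<le> vnorm (dual V) (\<sigma> m \<ominus>\<^bsub>dual V\<^esub> \<sigma> n) * vnorm V x"
      if "x \<in> carrier V" for m n x
      using dual_bound[OF D.minus_closed[OF s s] that, of m n] that
      by (simp add: dual_minus[OF s s])
    have "Cauchy (\<lambda>n. \<sigma> n x)" if x: "x \<in> carrier V" for x
    proof (rule CauchyI)
      fix e :: real assume e: "e > 0"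
      define d where "d = e / (1 + vnorm V x)"
      have d: "d > 0" using e vnorm_nonneg[OF x] by (simp add: d_def)
      obtain N where N: "\<And>m n. m \<ge> N \<Longrightarrow> n \<ge> N \<Longrightarrow> vnorm (dual V) (\<sigma> m \<ominus>\<^bsub>dual V\<^esub> \<sigma> n) < d"
        using Cau d by meson
      show "\<exists>M. \<forall>m\<ge>M. \<forall>n\<ge>M. norm (\<sigma> m x - \<sigma> n x) < e"
      proof (intro exI allI impI)
        fix m n assume mn: "m \<ge> N" "n \<ge> N"
        have "norm (\<sigma> m x - \<sigma> n x) \<le> d * vnorm V x"
          using diff[OF x, of m n] mult_right_mono[OF less_imp_le[OF N[OF mn]] vnorm_nonneg[OF x]]
          by linarith
        also have "\<dots> < d * (1 + vnorm V x)" using d by simp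
        also have "\<dots> = e" using vnorm_nonneg[OF x] by (simp add: d_def)
        finally show "norm (\<sigma> m x - \<sigma> n x) < e" .
      qed
    qed
    then have lim: "(\<lambda>n. \<sigma> n x) \<longlonglongrightarrow> lim (\<lambda>n. \<sigma> n x)" if "x \<in> carrier V" for x
      using that Cauchy_convergent_iff convergent_LIMSEQ_iff by blast
    define g where "g = (\<lambda>x\<in>carrier V. lim (\<lambda>n. \<sigma> n x))"
    have g: "(\<lambda>n. \<sigma> n x) \<longlonglongrightarrow> g x" if "x \<in> carrier V" for x
      using lim[OF that] that by (simp add: g_def)
    have est: "cmod (\<sigma> n x - g x) \<le> e * vnorm V x"
      if x: "x \<in> carrier V" and N: "\<And>m n. m \<ge> N \<Longrightarrow> n \<ge> N \<Longrightarrow> vnorm (dual V) (\<sigma> m \<ominus>\<^bsub>dual V\<^esub> \<sigma> n) < e"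
        and n: "n \<ge> N" for x e N n
    proof (rule Lim_bounded)
      show "(\<lambda>m. cmod (\<sigma> n x - \<sigma> m x)) \<longlonglongrightarrow> cmod (\<sigma> n x - g x)"
        by (intro tendsto_intros g x)
      show "\<forall>m\<ge>N. cmod (\<sigma> n x - \<sigma> m x) \<le> e * vnorm V x"
      proof (intro allI impI)
        fix m assume "m \<ge> N"
        then show "cmod (\<sigma> n x - \<sigma> m x) \<le> e * vnorm V x"
          using diff[OF x, of n m] mult_right_mono[OF less_imp_le[OF N[OF n]] vnorm_nonneg[OF x], of m]
          by linarith
      qed
    qed
    obtain N1 where N1: "\<And>m n. m \<ge> N1 \<Longrightarrow> n \<ge> N1 \<Longrightarrow> vnorm (dual V) (\<sigma> m \<ominus>\<^bsub>dual V\<^esub> \<sigma> n) < 1"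
      using Cau zero_less_one by meson
    have gd: "g \<in> carrier (dual V)"
    proof (rule dualI[of _ "1 + vnorm (dual V) (\<sigma> N1)"])
      show "g \<in> extensional (carrier V)" by (simp add: g_def)
      fix x assume x: "x \<in> carrier V"
      have "cmod (\<sigma> N1 x - g x) \<le> 1 * vnorm V x"
        by (rule est[OF x _ order_refl]) (rule N1)
      then show "cmod (g x) \<le> (1 + vnorm (dual V) (\<sigma> N1)) * vnorm V x"
        using dual_bound[OF s x, of N1] norm_triangle_ineq3[of "\<sigma> N1 x" "g x"]
        unfolding distrib_right by linarith
      show "g (c \<odot>\<^bsub>V\<^esub> x) = c * g x" for c
      proof (rule LIMSEQ_unique[of "\<lambda>n. \<sigma> n (c \<odot>\<^bsub>V\<^esub> x)"])
        show "(\<lambda>n. \<sigma> n (c \<odot>\<^bsub>V\<^esub> x)) \<longlonglongrightarrow> c * g x"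
          unfolding dual_smult[OF s x] by (intro tendsto_intros g x)
      qed (use x g in auto)
      fix y assume y: "y \<in> carrier V"
      show "g (x \<oplus>\<^bsub>V\<^esub> y) = g x + g y"
      proof (rule LIMSEQ_unique[of "\<lambda>n. \<sigma> n (x \<oplus>\<^bsub>V\<^esub> y)"])
        show "(\<lambda>n. \<sigma> n (x \<oplus>\<^bsub>V\<^esub> y)) \<longlonglongrightarrow> g x + g y"
          unfolding dual_add[OF s x y] by (intro tendsto_intros g x y)
      qed (use x y g in auto)
    qed
    show ?thesis
    proof (intro bexI[OF _ gd] allI impI)
      fix e :: real assume e: "e > 0"
      obtain N where N: "\<And>m n. m \<ge> N \<Longrightarrow> n \<ge> N \<Longrightarrow> vnorm (dual V) (\<sigma> m \<ominus>\<^bsub>dual V\<^esub> \<sigma> n) < e/2"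
        using Cau half_gt_zero[OF e] by meson
      show "\<exists>N. \<forall>n\<ge>N. vnorm (dual V) (\<sigma> n \<ominus>\<^bsub>dual V\<^esub> g) < e"
      proof (intro exI allI impI)
        fix n assume "n \<ge> N"
        have "vnorm (dual V) (\<sigma> n \<ominus>\<^bsub>dual V\<^esub> g) \<le> e/2"
        proof (rule dual_vnorm_le)
          show "cmod ((\<sigma> n \<ominus>\<^bsub>dual V\<^esub> g) x) \<le> e / 2 * vnorm V x" if "x \<in> carrier V" for x
            using est[OF that N \<open>n \<ge> N\<close>] that by (simp add: dual_minus[OF s gd])
        qed (use e in simp)
        then show "vnorm (dual V) (\<sigma> n \<ominus>\<^bsub>dual V\<^esub> g) < e" using e by simp
      qed
    qed
  qed
  then show ?thesis
    by (intro complex_banach_space.intro complex_banach_space_axioms.intro complex_normed_space_dual)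
       (simp add: D.mcomplete_iff)
qed

end


subsection \<open>The algebras \<open>phi_algebra\<close> and \<open>bidual_algebra\<close> are Banach algebras\<close>

lemma mult_update_simps [simp]:
  fixes V :: "'a normed_module"
  shows "carrier (V\<lparr>monoid.mult := f\<rparr>) = carrier V" "(\<otimes>\<^bsub>V\<lparr>monoid.mult := f\<rparr>\<^esub>) = f"
    "(\<oplus>\<^bsub>V\<lparr>monoid.mult := f\<rparr>\<^esub>) = (\<oplus>\<^bsub>V\<^esub>)" "\<zero>\<^bsub>V\<lparr>monoid.mult := f\<rparr>\<^esub> = \<zero>\<^bsub>V\<^esub>"
    "(\<odot>\<^bsub>V\<lparr>monoid.mult := f\<rparr>\<^esub>) = (\<odot>\<^bsub>V\<^esub>)" "vnorm (V\<lparr>monoid.mult := f\<rparr>) = vnorm V"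
  by simp_all

lemma complex_banach_space_mult_update:
  fixes V :: "'a normed_module"
  assumes "complex_banach_space V"
  shows "complex_banach_space (V\<lparr>monoid.mult := f\<rparr>)"
proof -
  have "vdist (V\<lparr>monoid.mult := f\<rparr>) = vdist V"
    by (intro ext) (simp add: vdist_def a_minus_def a_inv_def)
  then show ?thesis
    using assms
    by (simp add: complex_banach_space_def complex_banach_space_axioms_def complex_normed_space_def
        complex_normed_space_axioms_def module_def module_axioms_def abelian_group_def
        abelian_monoid_def abelian_group_axioms_def)
qed

lemma complex_banach_algebra_phi_algebra:
  assumes A: "complex_banach_space A"
    and \<phi>: "\<phi> \<in> carrier (dual A)" "vnorm (dual A) \<phi> \<le> 1"
  shows "complex_banach_algebra (phi_algebra \<phi> A)"
proof -
  interpret complex_banach_space A by (rule A)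
  show ?thesis
    unfolding phi_algebra_def
  proof (intro complex_banach_algebra.intro complex_banach_algebra_axioms.intro
      complex_banach_space_mult_update A)
    fix x y assume xy: "x \<in> carrier (A\<lparr>monoid.mult := \<lambda>a\<in>carrier A. \<lambda>b\<in>carrier A. \<phi> a \<odot>\<^bsub>A\<^esub> b\<rparr>)"
      "y \<in> carrier (A\<lparr>monoid.mult := \<lambda>a\<in>carrier A. \<lambda>b\<in>carrier A. \<phi> a \<odot>\<^bsub>A\<^esub> b\<rparr>)"
    have "cmod (\<phi> x) \<le> vnorm A x"
      using dual_bound[OF \<phi>(1), of x] mult_right_mono[OF \<phi>(2), of "vnorm A x"] vnorm_nonneg[of x] xy
      by simp
    then show "vnorm (A\<lparr>monoid.mult := \<lambda>a\<in>carrier A. \<lambda>b\<in>carrier A. \<phi> a \<odot>\<^bsub>A\<^esub> b\<rparr>)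
          (x \<otimes>\<^bsub>A\<lparr>monoid.mult := \<lambda>a\<in>carrier A. \<lambda>b\<in>carrier A. \<phi> a \<odot>\<^bsub>A\<^esub> b\<rparr>\<^esub> y)
        \<le> vnorm (A\<lparr>monoid.mult := \<lambda>a\<in>carrier A. \<lambda>b\<in>carrier A. \<phi> a \<odot>\<^bsub>A\<^esub> b\<rparr>) x *
           vnorm (A\<lparr>monoid.mult := \<lambda>a\<in>carrier A. \<lambda>b\<in>carrier A. \<phi> a \<odot>\<^bsub>A\<^esub> b\<rparr>) y"
      using xy by (simp add: vnorm_smult mult_right_mono vnorm_nonneg)
  qed (use \<phi> in \<open>simp_all add: dual_add dual_smult smult_l_distr[simplified] smult_r_distr[simplified]
      smult_assoc1[simplified, symmetric] mult.commute\<close>)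
qed

lemma dual_apply:
  "x \<in> carrier V \<Longrightarrow> (f \<oplus>\<^bsub>dual V\<^esub> g) x = f x + g x"
  "x \<in> carrier V \<Longrightarrow> (c \<odot>\<^bsub>dual V\<^esub> f) x = c * f x"
  by (simp_all add: dual_simps)

lemma extensional_simps:
  "f \<oplus>\<^bsub>dual V\<^esub> g \<in> extensional (carrier V)" "c \<odot>\<^bsub>dual V\<^esub> f \<in> extensional (carrier V)"
  "act_fa V f a \<in> extensional (carrier V)" "act_nf V n f \<in> extensional (carrier V)"
  "arens_box V m n \<in> extensional (carrier (dual V))"
  by (simp_all add: dual_simps act_fa_def act_nf_def arens_box_def)

context complex_banach_algebra
begin

sublocale D: complex_banach_space "dual V" by (rule complex_banach_space_dual)
sublocale DD: complex_banach_space "dual (dual V)" by (rule D.complex_banach_space_dual)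

lemma act_fa_bound:
  assumes "f \<in> carrier (dual V)" "a \<in> carrier V" "b \<in> carrier V"
  shows "cmod (act_fa V f a b) \<le> vnorm (dual V) f * vnorm V a * vnorm V b"
proof -
  have "cmod (act_fa V f a b) \<le> vnorm (dual V) f * vnorm V (a \<otimes>\<^bsub>V\<^esub> b)"
    using assms dual_bound[OF assms(1) mult_closed] by (simp add: act_fa_def)
  also have "\<dots> \<le> vnorm (dual V) f * (vnorm V a * vnorm V b)"
    using assms by (intro mult_left_mono vnorm_mult dual_vnorm_nonneg)
  finally show ?thesis by (simp add: mult.assoc)
qed

lemma act_fa_closed:
  assumes "f \<in> carrier (dual V)" "a \<in> carrier V"
  shows "act_fa V f a \<in> carrier (dual V)"
proof (rule dualI[of _ "vnorm (dual V) f * vnorm V a"])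
  show "cmod (act_fa V f a x) \<le> vnorm (dual V) f * vnorm V a * vnorm V x" if "x \<in> carrier V" for x
    using act_fa_bound[OF assms that] .
qed (use assms in \<open>auto simp: act_fa_def mult_add_right mult_smult_right mult_closed dual_add dual_smult\<close>)

lemma act_fa_vnorm:
  assumes "f \<in> carrier (dual V)" "a \<in> carrier V"
  shows "vnorm (dual V) (act_fa V f a) \<le> vnorm (dual V) f * vnorm V a"
  using assms by (intro dual_vnorm_le act_fa_bound mult_nonneg_nonneg dual_vnorm_nonneg vnorm_nonneg)

lemma act_fa_linear:
  assumes "f \<in> carrier (dual V)" "g \<in> carrier (dual V)" "a \<in> carrier V" "b \<in> carrier V"
  shows "act_fa V (f \<oplus>\<^bsub>dual V\<^esub> g) a = act_fa V f a \<oplus>\<^bsub>dual V\<^esub> act_fa V g a"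
    and "act_fa V (c \<odot>\<^bsub>dual V\<^esub> f) a = c \<odot>\<^bsub>dual V\<^esub> act_fa V f a"
    and "act_fa V f (a \<oplus>\<^bsub>V\<^esub> b) = act_fa V f a \<oplus>\<^bsub>dual V\<^esub> act_fa V f b"
    and "act_fa V f (c \<odot>\<^bsub>V\<^esub> a) = c \<odot>\<^bsub>dual V\<^esub> act_fa V f a"
    and "act_fa V f (a \<otimes>\<^bsub>V\<^esub> b) = act_fa V (act_fa V f a) b"
  using assms
  by (auto simp: act_fa_def dual_simps mult_closed mult_add_left mult_smult_left mult_assoc
      dual_add dual_smult intro!: restrict_ext)

lemma act_nf_bound:
  assumes "n \<in> carrier (dual (dual V))" "f \<in> carrier (dual V)" "a \<in> carrier V"
  shows "cmod (act_nf V n f a) \<le> vnorm (dual (dual V)) n * vnorm (dual V) f * vnorm V a"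
proof -
  have "cmod (act_nf V n f a) \<le> vnorm (dual (dual V)) n * vnorm (dual V) (act_fa V f a)"
    using assms D.dual_bound[OF assms(1) act_fa_closed] by (simp add: act_nf_def)
  also have "\<dots> \<le> vnorm (dual (dual V)) n * (vnorm (dual V) f * vnorm V a)"
    using assms by (intro mult_left_mono act_fa_vnorm D.dual_vnorm_nonneg)
  finally show ?thesis by (simp add: mult.assoc)
qed

lemma act_nf_closed:
  assumes "n \<in> carrier (dual (dual V))" "f \<in> carrier (dual V)"
  shows "act_nf V n f \<in> carrier (dual V)"
proof (rule dualI[of _ "vnorm (dual (dual V)) n * vnorm (dual V) f"])
  show "cmod (act_nf V n f x) \<le> vnorm (dual (dual V)) n * vnorm (dual V) f * vnorm V x"
    if "x \<in> carrier V" for x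
    using act_nf_bound[OF assms that] .
qed (use assms in \<open>auto simp: act_nf_def act_fa_linear act_fa_closed dual_add dual_smult\<close>)

lemma act_nf_vnorm:
  assumes "n \<in> carrier (dual (dual V))" "f \<in> carrier (dual V)"
  shows "vnorm (dual V) (act_nf V n f) \<le> vnorm (dual (dual V)) n * vnorm (dual V) f"
  using assms
  by (intro dual_vnorm_le act_nf_bound mult_nonneg_nonneg dual_vnorm_nonneg D.dual_vnorm_nonneg)

lemma act_nf_add_right:
  assumes "n \<in> carrier (dual (dual V))" "f \<in> carrier (dual V)" "g \<in> carrier (dual V)"
  shows "act_nf V n (f \<oplus>\<^bsub>dual V\<^esub> g) = act_nf V n f \<oplus>\<^bsub>dual V\<^esub> act_nf V n g"
proof (rule dual_eqI[of _ V])
  fix a assume a: "a \<in> carrier V"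
  show "act_nf V n (f \<oplus>\<^bsub>dual V\<^esub> g) a = (act_nf V n f \<oplus>\<^bsub>dual V\<^esub> act_nf V n g) a"
    using assms a by (simp add: dual_apply act_nf_def act_fa_linear act_fa_closed dual_add)
qed (simp_all add: extensional_simps)

lemma act_nf_smult_right:
  assumes "n \<in> carrier (dual (dual V))" "f \<in> carrier (dual V)"
  shows "act_nf V n (c \<odot>\<^bsub>dual V\<^esub> f) = c \<odot>\<^bsub>dual V\<^esub> act_nf V n f"
proof (rule dual_eqI[of _ V])
  fix a assume a: "a \<in> carrier V"
  show "act_nf V n (c \<odot>\<^bsub>dual V\<^esub> f) a = (c \<odot>\<^bsub>dual V\<^esub> act_nf V n f) a"
    using assms a by (simp add: dual_apply act_nf_def act_fa_linear act_fa_closed dual_smult)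
qed (simp_all add: extensional_simps)

lemma act_nf_add_left:
  assumes "m \<in> carrier (dual (dual V))" "n \<in> carrier (dual (dual V))" "f \<in> carrier (dual V)"
  shows "act_nf V (m \<oplus>\<^bsub>dual (dual V)\<^esub> n) f = act_nf V m f \<oplus>\<^bsub>dual V\<^esub> act_nf V n f"
proof (rule dual_eqI[of _ V])
  fix a assume a: "a \<in> carrier V"
  show "act_nf V (m \<oplus>\<^bsub>dual (dual V)\<^esub> n) f a = (act_nf V m f \<oplus>\<^bsub>dual V\<^esub> act_nf V n f) a"
    using assms a by (simp add: dual_apply act_nf_def act_fa_closed)
qed (simp_all add: extensional_simps)

lemma act_nf_smult_left:
  assumes "n \<in> carrier (dual (dual V))" "f \<in> carrier (dual V)"
  shows "act_nf V (c \<odot>\<^bsub>dual (dual V)\<^esub> n) f = c \<odot>\<^bsub>dual V\<^esub> act_nf V n f"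
proof (rule dual_eqI[of _ V])
  fix a assume a: "a \<in> carrier V"
  show "act_nf V (c \<odot>\<^bsub>dual (dual V)\<^esub> n) f a = (c \<odot>\<^bsub>dual V\<^esub> act_nf V n f) a"
    using assms a by (simp add: dual_apply act_nf_def act_fa_closed)
qed (simp_all add: extensional_simps)

lemma act_nf_act_fa:
  assumes "n \<in> carrier (dual (dual V))" "f \<in> carrier (dual V)" "a \<in> carrier V"
  shows "act_nf V n (act_fa V f a) = act_fa V (act_nf V n f) a"
proof (rule dual_eqI[of _ V])
  fix b assume b: "b \<in> carrier V"
  have "act_fa V (act_nf V n f) a b = n (act_fa V f (a \<otimes>\<^bsub>V\<^esub> b))"
    using assms b mult_closed[of a b] by (simp only: act_fa_def[of V "act_nf V n f"])
      (simp add: act_nf_def)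
  then show "act_nf V n (act_fa V f a) b = act_fa V (act_nf V n f) a b"
    using assms b by (simp add: act_nf_def act_fa_linear(5))
qed (simp_all add: extensional_simps)

lemma arens_box_bound:
  assumes "m \<in> carrier (dual (dual V))" "n \<in> carrier (dual (dual V))" "f \<in> carrier (dual V)"
  shows "cmod (arens_box V m n f)
    \<le> vnorm (dual (dual V)) m * vnorm (dual (dual V)) n * vnorm (dual V) f"
proof -
  have "cmod (arens_box V m n f) \<le> vnorm (dual (dual V)) m * vnorm (dual V) (act_nf V n f)"
    using assms D.dual_bound[OF assms(1) act_nf_closed] by (simp add: arens_box_def)
  also have "\<dots> \<le> vnorm (dual (dual V)) m * (vnorm (dual (dual V)) n * vnorm (dual V) f)"
    using assms by (intro mult_left_mono act_nf_vnorm D.dual_vnorm_nonneg)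
  finally show ?thesis by (simp add: mult.assoc)
qed

lemma arens_box_closed:
  assumes "m \<in> carrier (dual (dual V))" "n \<in> carrier (dual (dual V))"
  shows "arens_box V m n \<in> carrier (dual (dual V))"
proof (rule D.dualI[of _ "vnorm (dual (dual V)) m * vnorm (dual (dual V)) n"])
  show "cmod (arens_box V m n x) \<le> vnorm (dual (dual V)) m * vnorm (dual (dual V)) n * vnorm (dual V) x"
    if "x \<in> carrier (dual V)" for x
    using arens_box_bound[OF assms that] .
qed (use assms in \<open>auto simp: arens_box_def act_nf_add_right act_nf_smult_right
      act_nf_closed dual_add dual_smult\<close>)

lemma act_nf_arens_box:
  assumes "m \<in> carrier (dual (dual V))" "n \<in> carrier (dual (dual V))" "f \<in> carrier (dual V)"
  shows "act_nf V (arens_box V m n) f = act_nf V m (act_nf V n f)"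
proof (rule dual_eqI[of _ V])
  fix a assume a: "a \<in> carrier V"
  have "act_nf V (arens_box V m n) f a = m (act_nf V n (act_fa V f a))"
    using assms a by (simp only: act_nf_def[of V "arens_box V m n"])
      (simp add: arens_box_def act_fa_closed)
  then show "act_nf V (arens_box V m n) f a = act_nf V m (act_nf V n f) a"
    using assms a by (simp add: act_nf_act_fa act_nf_def[of V m])
qed (simp_all add: extensional_simps)

lemma arens_box_vnorm:
  assumes "m \<in> carrier (dual (dual V))" "n \<in> carrier (dual (dual V))"
  shows "vnorm (dual (dual V)) (arens_box V m n) \<le> vnorm (dual (dual V)) m * vnorm (dual (dual V)) n"
  using assms by (intro D.dual_vnorm_le arens_box_bound mult_nonneg_nonneg D.dual_vnorm_nonneg)

lemma arens_box_bilinear: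
  assumes "m \<in> carrier (dual (dual V))" "n \<in> carrier (dual (dual V))" "p \<in> carrier (dual (dual V))"
  shows "arens_box V (m \<oplus>\<^bsub>dual (dual V)\<^esub> n) p = arens_box V m p \<oplus>\<^bsub>dual (dual V)\<^esub> arens_box V n p"
    and "arens_box V m (n \<oplus>\<^bsub>dual (dual V)\<^esub> p) = arens_box V m n \<oplus>\<^bsub>dual (dual V)\<^esub> arens_box V m p"
    and "arens_box V (c \<odot>\<^bsub>dual (dual V)\<^esub> m) n = c \<odot>\<^bsub>dual (dual V)\<^esub> arens_box V m n"
    and "arens_box V m (c \<odot>\<^bsub>dual (dual V)\<^esub> n) = c \<odot>\<^bsub>dual (dual V)\<^esub> arens_box V m n"
    and "arens_box V (arens_box V m n) p = arens_box V m (arens_box V n p)"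
  using assms
  by (auto intro!: dual_eqI[of _ "dual V"] simp: extensional_simps dual_apply arens_box_def[of V]
      act_nf_add_left act_nf_smult_left act_nf_closed dual_add dual_smult
      act_nf_arens_box[unfolded arens_box_def])

lemma complex_banach_algebra_bidual_algebra: "complex_banach_algebra (bidual_algebra V)"
  unfolding bidual_algebra_def
proof (intro complex_banach_algebra.intro complex_banach_algebra_axioms.intro
    complex_banach_space_mult_update)
  show "complex_banach_space (dual (dual V))" by unfold_locales
qed (simp_all add: arens_box_closed arens_box_bilinear arens_box_vnorm D.dual_add_closed
    D.dual_smult_closed)

end


subsection \<open>Even duals exist for every \<open>n\<close>\<close>

lemma isometric_isoD:
  assumes "isometric_iso h V W"
  shows "bij_betw h (carrier V) (carrier W)"
    and "x \<in> carrier V \<Longrightarrow> h x \<in> carrier W"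
    and "\<lbrakk>x \<in> carrier V; y \<in> carrier V\<rbrakk> \<Longrightarrow> h (x \<oplus>\<^bsub>V\<^esub> y) = h x \<oplus>\<^bsub>W\<^esub> h y"
    and "x \<in> carrier V \<Longrightarrow> h (c \<odot>\<^bsub>V\<^esub> x) = c \<odot>\<^bsub>W\<^esub> h x"
    and "x \<in> carrier V \<Longrightarrow> vnorm W (h x) = vnorm V x"
  using assms by (auto simp: isometric_iso_def bij_betw_def)

lemma isometric_algebra_iso_refl: "isometric_algebra_iso (\<lambda>x. x) B B"
  by (auto simp: isometric_algebra_iso_def isometric_iso_def bij_betw_def)

lemma isometric_algebra_iso_trans:
  assumes "isometric_algebra_iso h B C" "isometric_algebra_iso k C D"
  shows "isometric_algebra_iso (k \<circ> h) B D"
  using assms isometric_isoD(2)[of h B C]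
  by (auto simp: isometric_algebra_iso_def isometric_iso_def intro: bij_betw_trans)

text \<open>The map of duals induced by an isometric isomorphism \<open>h\<close> from \<open>V\<close> onto \<open>W\<close>.\<close>

definition dual_map where
  "dual_map h V W f = (\<lambda>y\<in>carrier W. f (inv_into (carrier V) h y))"

lemma dual_map_apply:
  assumes "isometric_iso h V W" "x \<in> carrier V"
  shows "dual_map h V W f (h x) = f x"
  using assms isometric_isoD(1,2)[OF assms(1)] by (simp add: dual_map_def bij_betw_def inv_into_f_f)

lemma isometric_iso_dual_map:
  assumes V: "complex_normed_space V" and W: "complex_normed_space W" and h: "isometric_iso h V W"
  shows "isometric_iso (dual_map h V W) (dual V) (dual W)"
proof -
  interpret V: complex_normed_space V by (rule V)
  interpret W: complex_normed_space W by (rule W)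
  note h' = isometric_isoD[OF h]
  have surj: "\<exists>x\<in>carrier V. y = h x" if "y \<in> carrier W" for y
    using that h'(1) by (auto simp: bij_betw_def)
  have ext: "dual_map h V W f \<in> extensional (carrier W)" for f by (simp add: dual_map_def)
  have closed: "dual_map h V W f \<in> carrier (dual W)" if f: "f \<in> carrier (dual V)" for f
  proof (rule W.dualI[OF ext])
    fix y assume "y \<in> carrier W"
    then obtain x where x: "x \<in> carrier V" "y = h x" using surj by blast
    show "cmod (dual_map h V W f y) \<le> vnorm (dual V) f * vnorm W y"
      using x V.dual_bound[OF f] by (simp add: dual_map_apply[OF h] h')
    show "dual_map h V W f (c \<odot>\<^bsub>W\<^esub> y) = c * dual_map h V W f y" for c
      using x dual_map_apply[OF h, of "c \<odot>\<^bsub>V\<^esub> x" f] dual_smult[OF f]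
      by (simp add: dual_map_apply[OF h] h')
    fix z assume "z \<in> carrier W"
    then obtain w where w: "w \<in> carrier V" "z = h w" using surj by blast
    show "dual_map h V W f (y \<oplus>\<^bsub>W\<^esub> z) = dual_map h V W f y + dual_map h V W f z"
      using x w dual_map_apply[OF h, of "x \<oplus>\<^bsub>V\<^esub> w" f] dual_add[OF f]
      by (simp add: dual_map_apply[OF h] h')
  qed
  have inv: "(\<lambda>x\<in>carrier V. g (h x)) \<in> carrier (dual V)" if g: "g \<in> carrier (dual W)" for g
  proof (rule V.dualI[of _ "vnorm (dual W) g"])
    fix x assume x: "x \<in> carrier V"
    show "cmod ((\<lambda>x\<in>carrier V. g (h x)) x) \<le> vnorm (dual W) g * vnorm V x"
      using x W.dual_bound[OF g h'(2)[OF x]] by (simp add: h')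
    show "(\<lambda>x\<in>carrier V. g (h x)) (c \<odot>\<^bsub>V\<^esub> x) = c * (\<lambda>x\<in>carrier V. g (h x)) x" for c
      using x by (simp add: h' dual_smult[OF g])
    fix y assume y: "y \<in> carrier V"
    show "(\<lambda>x\<in>carrier V. g (h x)) (x \<oplus>\<^bsub>V\<^esub> y)
        = (\<lambda>x\<in>carrier V. g (h x)) x + (\<lambda>x\<in>carrier V. g (h x)) y"
      using x y by (simp add: h' dual_add[OF g])
  qed simp
  have eqW: "F = G" if "F \<in> extensional (carrier W)" "G \<in> extensional (carrier W)"
    "\<And>x. x \<in> carrier V \<Longrightarrow> F (h x) = G (h x)" for F G :: "_ \<Rightarrow> complex"
    using that surj by (intro dual_eqI[of F W G]) auto
  have bij: "bij_betw (dual_map h V W) (carrier (dual V)) (carrier (dual W))"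
  proof (rule bij_betw_byWitness[where f' = "\<lambda>g. \<lambda>x\<in>carrier V. g (h x)"])
    show "\<forall>f\<in>carrier (dual V). (\<lambda>x\<in>carrier V. dual_map h V W f (h x)) = f"
    proof
      fix f assume f: "f \<in> carrier (dual V)"
      show "(\<lambda>x\<in>carrier V. dual_map h V W f (h x)) = f"
        by (rule dual_eqI[of _ V]) (simp_all add: dual_map_apply[OF h] dual_ext[OF f])
    qed
    show "\<forall>g\<in>carrier (dual W). dual_map h V W (\<lambda>x\<in>carrier V. g (h x)) = g"
    proof
      fix g assume g: "g \<in> carrier (dual W)"
      show "dual_map h V W (\<lambda>x\<in>carrier V. g (h x)) = g"
        by (rule eqW) (simp_all add: ext dual_map_apply[OF h] dual_ext[OF g])
    qed
  qed (use closed inv in auto)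
  have "vnorm (dual W) (dual_map h V W f) = vnorm (dual V) f" for f
  proof -
    have ball: "{y \<in> carrier W. vnorm W y \<le> 1} = h ` {x \<in> carrier V. vnorm V x \<le> 1}"
      using surj h'(2,5) by auto (metis (mono_tags, lifting) image_eqI mem_Collect_eq)
    show ?thesis
      unfolding dual_vnorm ball image_image
      by (rule SUP_cong) (simp_all add: dual_map_apply[OF h])
  qed
  moreover have "dual_map h V W (f \<oplus>\<^bsub>dual V\<^esub> g) = dual_map h V W f \<oplus>\<^bsub>dual W\<^esub> dual_map h V W g" for f g
    by (rule eqW) (simp_all add: ext extensional_simps dual_map_apply[OF h] dual_apply h')
  moreover have "dual_map h V W (c \<odot>\<^bsub>dual V\<^esub> f) = c \<odot>\<^bsub>dual W\<^esub> dual_map h V W f" for c f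
    by (rule eqW) (simp_all add: ext extensional_simps dual_map_apply[OF h] dual_apply h')
  ultimately show ?thesis using bij by (simp add: isometric_iso_def)
qed

lemma isometric_algebra_iso_bidual:
  assumes B: "complex_banach_algebra B" and C: "complex_banach_algebra C"
    and h: "isometric_algebra_iso h B C"
  shows "isometric_algebra_iso (dual_map (dual_map h B C) (dual B) (dual C))
    (bidual_algebra B) (bidual_algebra C)"
proof -
  interpret B: complex_banach_algebra B by (rule B)
  interpret C: complex_banach_algebra C by (rule C)
  let ?H = "dual_map h B C"
  let ?T = "dual_map ?H (dual B) (dual C)"
  have h1: "isometric_iso h B C"
    and hm: "\<And>x y. \<lbrakk>x \<in> carrier B; y \<in> carrier B\<rbrakk> \<Longrightarrow> h (x \<otimes>\<^bsub>B\<^esub> y) = h x \<otimes>\<^bsub>C\<^esub> h y"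
    using h by (simp_all add: isometric_algebra_iso_def)
  have h2: "isometric_iso ?H (dual B) (dual C)"
    by (rule isometric_iso_dual_map[OF _ _ h1]) unfold_locales
  have h3: "isometric_iso ?T (dual (dual B)) (dual (dual C))"
    by (rule isometric_iso_dual_map[OF _ _ h2]) unfold_locales
  have eqC: "F = G" if "F \<in> extensional (carrier C)" "G \<in> extensional (carrier C)"
    "\<And>x. x \<in> carrier B \<Longrightarrow> F (h x) = G (h x)" for F G :: "_ \<Rightarrow> complex"
  proof (rule dual_eqI[of F C G, OF that(1,2)])
    fix y assume "y \<in> carrier C"
    then obtain x where "x \<in> carrier B" "y = h x"
      using isometric_isoD(1)[OF h1] by (auto simp: bij_betw_def)
    then show "F y = G y" using that(3) by simp
  qed
  have fa: "act_fa C (?H f) (h x) = ?H (act_fa B f x)"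
    if "f \<in> carrier (dual B)" "x \<in> carrier B" for f x
  proof (rule eqC)
    fix z assume z: "z \<in> carrier B"
    show "act_fa C (?H f) (h x) (h z) = ?H (act_fa B f x) (h z)"
      using that z dual_map_apply[OF h1, of "x \<otimes>\<^bsub>B\<^esub> z" f] B.mult_closed
      by (simp add: dual_map_apply[OF h1] act_fa_def isometric_isoD(2)[OF h1] hm)
  qed (simp_all add: extensional_simps dual_map_def)
  have nf: "act_nf C (?T n) (?H f) = ?H (act_nf B n f)"
    if "n \<in> carrier (dual (dual B))" "f \<in> carrier (dual B)" for n f
  proof (rule eqC)
    fix z assume z: "z \<in> carrier B"
    show "act_nf C (?T n) (?H f) (h z) = ?H (act_nf B n f) (h z)"
      using that z
      by (simp add: dual_map_apply[OF h1] act_nf_def isometric_isoD(2)[OF h1] fa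
          dual_map_apply[OF h2] B.act_fa_closed)
  qed (simp_all add: extensional_simps dual_map_def)
  have box: "?T (arens_box B m n) = arens_box C (?T m) (?T n)"
    if m: "m \<in> carrier (dual (dual B))" and n: "n \<in> carrier (dual (dual B))" for m n
  proof (rule dual_eqI[of _ "dual C"])
    fix g assume "g \<in> carrier (dual C)"
    then obtain f where f: "f \<in> carrier (dual B)" "g = ?H f"
      using isometric_isoD(1)[OF h2] by (auto simp: bij_betw_def)
    show "?T (arens_box B m n) g = arens_box C (?T m) (?T n) g"
      using f m n
      by (simp add: dual_map_apply[OF h2] arens_box_def isometric_isoD(2)[OF h2] nf B.act_nf_closed)
  qed (simp_all add: extensional_simps dual_map_def)
  show ?thesis
    using h3 isometric_isoD(2)[OF h3]
    by (simp add: isometric_algebra_iso_def isometric_iso_def bidual_algebra_def box)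
qed

definition transport :: "('u \<Rightarrow> 'v) \<Rightarrow> 'u normed_module \<Rightarrow> 'v normed_module" where
  "transport e C = \<lparr>
     carrier = e ` carrier C,
     monoid.mult = (\<lambda>x y. e (inv_into UNIV e x \<otimes>\<^bsub>C\<^esub> inv_into UNIV e y)),
     monoid.one = undefined,
     zero = e \<zero>\<^bsub>C\<^esub>,
     add = (\<lambda>x y. e (inv_into UNIV e x \<oplus>\<^bsub>C\<^esub> inv_into UNIV e y)),
     module.smult = (\<lambda>c x. e (c \<odot>\<^bsub>C\<^esub> inv_into UNIV e x)),
     vnorm = (\<lambda>x. vnorm C (inv_into UNIV e x))\<rparr>"

lemma transport_simps:
  assumes "inj e"
  shows "carrier (transport e C) = e ` carrier C" "\<zero>\<^bsub>transport e C\<^esub> = e \<zero>\<^bsub>C\<^esub>"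
    "e x \<otimes>\<^bsub>transport e C\<^esub> e y = e (x \<otimes>\<^bsub>C\<^esub> y)" "e x \<oplus>\<^bsub>transport e C\<^esub> e y = e (x \<oplus>\<^bsub>C\<^esub> y)"
    "c \<odot>\<^bsub>transport e C\<^esub> e x = e (c \<odot>\<^bsub>C\<^esub> x)" "vnorm (transport e C) (e x) = vnorm C x"
  using assms by (simp_all add: transport_def)

lemma isometric_algebra_iso_transport:
  assumes "inj e"
  shows "isometric_algebra_iso e C (transport e C)"
    and "isometric_algebra_iso (inv_into UNIV e) (transport e C) C"
  using assms
  by (auto simp: isometric_algebra_iso_def isometric_iso_def transport_simps bij_betw_def inj_on_def
      image_image)

lemma complex_banach_algebra_transport:
  assumes e: "inj e" and C: "complex_banach_algebra C"
  shows "complex_banach_algebra (transport e C)"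
proof -
  interpret C: complex_banach_algebra C by (rule C)
  note [simp] = transport_simps[OF e]
  have ag: "abelian_group (transport e C)"
  proof (rule abelian_groupI)
    fix x assume "x \<in> carrier (transport e C)"
    then obtain a where a: "a \<in> carrier C" "x = e a" by auto
    show "\<exists>y\<in>carrier (transport e C). y \<oplus>\<^bsub>transport e C\<^esub> x = \<zero>\<^bsub>transport e C\<^esub>"
      by (rule bexI[of _ "e (\<ominus>\<^bsub>C\<^esub> a)"]) (use a C.M.l_neg[of a] in auto)
  next
    fix x y assume "x \<in> carrier (transport e C)" "y \<in> carrier (transport e C)"
    then show "x \<oplus>\<^bsub>transport e C\<^esub> y = y \<oplus>\<^bsub>transport e C\<^esub> x"
      by (auto simp: C.M.a_comm)
  qed (auto simp: C.M.a_assoc)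
  have mod: "module complex_ring (transport e C)"
    by (rule moduleI)
       (auto simp: cring_complex_ring ag C.smult_l_distr[simplified] C.smult_r_distr[simplified]
          C.smult_assoc1[simplified] C.smult_one[simplified])
  have ns: "complex_normed_space (transport e C)"
    unfolding complex_normed_space_def complex_normed_space_axioms_def
    using C.vnorm_eq_0_iff C.vnorm_triangle C.vnorm_smult e by (auto simp: mod inj_eq)
  interpret T: complex_normed_space "transport e C" by (rule ns)
  have minus: "e x \<ominus>\<^bsub>transport e C\<^esub> e y = e (x \<ominus>\<^bsub>C\<^esub> y)" if "x \<in> carrier C" "y \<in> carrier C" for x y
    using that T.minus_eq_smult[of "e x" "e y"] C.minus_eq_smult[of x y] by simp
  have lim: "\<exists>x\<in>carrier (transport e C). \<forall>r>0. \<exists>N. \<forall>n\<ge>N.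
      vnorm (transport e C) (\<sigma> n \<ominus>\<^bsub>transport e C\<^esub> x) < r"
    if \<sigma>: "range \<sigma> \<subseteq> carrier (transport e C)"
      and Cau: "\<forall>r>0. \<exists>N. \<forall>m\<ge>N. \<forall>n\<ge>N.
        vnorm (transport e C) (\<sigma> m \<ominus>\<^bsub>transport e C\<^esub> \<sigma> n) < r"
    for \<sigma> :: "nat \<Rightarrow> _"
  proof -
    define \<tau> where "\<tau> n = inv_into UNIV e (\<sigma> n)" for n
    have \<tau>: "\<tau> n \<in> carrier C" "\<sigma> n = e (\<tau> n)" for n
    proof -
      have "\<sigma> n \<in> e ` carrier C" using \<sigma> by auto
      then show "\<tau> n \<in> carrier C" "\<sigma> n = e (\<tau> n)" using e by (auto simp: \<tau>_def)
    qed
    have "range \<tau> \<subseteq> carrier C" using \<tau> by auto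
    moreover have "\<forall>r>0. \<exists>N. \<forall>m\<ge>N. \<forall>n\<ge>N. vnorm C (\<tau> m \<ominus>\<^bsub>C\<^esub> \<tau> n) < r"
      using Cau by (simp add: \<tau>(2) minus \<tau>(1))
    ultimately obtain x where x: "x \<in> carrier C"
      "\<forall>r>0. \<exists>N. \<forall>n\<ge>N. vnorm C (\<tau> n \<ominus>\<^bsub>C\<^esub> x) < r"
      using C.complete[unfolded C.mcomplete_iff, rule_format, of \<tau>] by auto
    show ?thesis
      by (rule bexI[of _ "e x"]) (use x in \<open>simp_all add: \<tau>(2) minus \<tau>(1)\<close>)
  qed
  have "Metric_space.mcomplete (carrier (transport e C)) (vdist (transport e C))"
    unfolding T.mcomplete_iff by (intro allI impI) (rule lim)
  then have bs: "complex_banach_space (transport e C)"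
    by (intro complex_banach_space.intro complex_banach_space_axioms.intro ns)
  show ?thesis
    unfolding complex_banach_algebra_def complex_banach_algebra_axioms_def
    using bs
    by (auto simp: C.mult_closed C.mult_assoc C.mult_add_left C.mult_add_right C.mult_smult_left
        C.mult_smult_right C.vnorm_mult)
qed

lemma even_dual_complex_banach_algebra: "even_dual B n C \<Longrightarrow> complex_banach_algebra C"
  by (induction rule: even_dual.induct) auto

lemma even_dual_transport:
  fixes e :: "'u \<Rightarrow> 'v"
  assumes "even_dual B n C" and e: "inj e"
  shows "even_dual B n (transport e C)"
  using assms(1)
proof (induction rule: even_dual.induct)
  case (zero C h)
  then show ?case
    using isometric_algebra_iso_trans isometric_algebra_iso_transport(2)[OF e]
      complex_banach_algebra_transport[OF e] even_dual.zero by blast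
next
  case (Suc n C D h)
  have "isometric_algebra_iso (h \<circ> inv_into UNIV e) (transport e D) (bidual_algebra C)"
    using isometric_algebra_iso_trans isometric_algebra_iso_transport(2)[OF e] Suc by blast
  moreover note isometric_algebra_iso_bidual[OF even_dual_complex_banach_algebra
      even_dual_complex_banach_algebra isometric_algebra_iso_transport(1)[OF e], OF Suc(1) Suc.IH]
  ultimately show ?case
    using isometric_algebra_iso_trans complex_banach_algebra_transport[OF e Suc(2)]
      even_dual.Suc[OF Suc.IH] by blast
qed

theorem even_dual_0: "complex_banach_algebra B \<Longrightarrow> even_dual B 0 B"
  by (rule even_dual.zero[OF _ isometric_algebra_iso_refl])

theorem even_dual_bidual_algebra:
  fixes C :: "'u normed_module"
  assumes "even_dual B n C"
  shows "even_dual B (Suc n) (bidual_algebra C)"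
proof -
  define e :: "'u \<Rightarrow> ('u \<Rightarrow> complex) \<Rightarrow> complex" where "e x = (\<lambda>f. f x)" for x
  have e: "inj e"
  proof (rule injI)
    fix x y assume "e x = e y"
    then have "e x (\<lambda>z. if z = x then 1 else 0) = e y (\<lambda>z. if z = x then 1 else 0)" by simp
    then show "x = y" by (simp add: e_def split: if_splits)
  qed
  note C = even_dual_complex_banach_algebra[OF assms]
  show ?thesis
    using even_dual_transport[OF assms e]
  proof (rule even_dual.Suc)
    show "complex_banach_algebra (bidual_algebra C)"
      by (rule complex_banach_algebra.complex_banach_algebra_bidual_algebra[OF C])
    show "isometric_algebra_iso (dual_map (dual_map e C (transport e C)) (dual C) (dual (transport e C)))
        (bidual_algebra C) (bidual_algebra (transport e C))"
      by (rule isometric_algebra_iso_bidual[OF C complex_banach_algebra_transport[OF e C]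
            isometric_algebra_iso_transport(1)[OF e]])
  qed
qed

end

theory Submission
  imports Defs
begin

text \<open>If \<open>x \<otimes> y = \<psi> x \<odot> y\<close> for a bounded functional \<open>\<psi>\<close>, then \<open>m \<box> n\<close> and \<open>m \<diamond> n\<close> both evaluate
  to \<open>m \<psi> \<odot> n\<close>. So the algebra is Arens regular, and its bidual has a product of the same form,
  with \<open>\<psi>\<close> replaced by its canonical image in the third dual. This shape of the product is also
  invariant under isomorphism, hence inherited by all even duals.\<close>

locale functional_product_algebra = complex_banach_algebra V
  for V :: "('a, 'm) normed_module_scheme" (structure) +
  fixes \<psi> :: "'a \<Rightarrow> complex"
  assumes functional: "\<psi> \<in> carrier (dual V)"
    and mult_eq_smult: "\<lbrakk>x \<in> carrier V; y \<in> carrier V\<rbrakk> \<Longrightarrow> x \<otimes> y = \<psi> x \<odot> y"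

section \<open>The canonical embedding into the bidual\<close>

context complex_normed_space
begin

lemma canon_closed:
  assumes "x \<in> carrier V"
  shows "canon V x \<in> carrier (dual (dual V))"
proof -
  interpret D: complex_normed_space "dual V" by (rule complex_normed_space_dual)
  show ?thesis
  proof (rule D.dualI[of _ "vnorm V x"])
    show "cmod (canon V x f) \<le> vnorm V x * vnorm (dual V) f" if "f \<in> carrier (dual V)" for f
      using dual_bound[OF that assms] that by (simp add: canon_def mult.commute)
  qed (use assms in \<open>auto simp: canon_def dual_simps[of V] dual_add_closed[unfolded dual_simps]
      dual_smult_closed[unfolded dual_simps]\<close>)
qed

lemma canon_add:
  assumes "x \<in> carrier V" "y \<in> carrier V"
  shows "canon V (x \<oplus> y) = canon V x \<oplus>\<^bsub>dual (dual V)\<^esub> canon V y"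
  using assms by (auto simp: canon_def dual_simps(2)[of "dual V"] dual_add intro!: restrict_ext)

lemma canon_smult:
  assumes "x \<in> carrier V"
  shows "canon V (c \<odot> x) = c \<odot>\<^bsub>dual (dual V)\<^esub> canon V x"
  using assms by (auto simp: canon_def dual_simps(3)[of "dual V"] dual_smult intro!: restrict_ext)

lemma canon_zero: "canon V \<zero> = \<zero>\<^bsub>dual (dual V)\<^esub>"
  using canon_smult[of \<zero> 0] by (auto simp: dual_simps canon_def smult_l_null[simplified])

text \<open>A non-zero functional has a non-zero value, and rescaling the argument by
  \<open>c / f a\<close> produces any other. With \<open>c = 1\<close> this supplies left
  identities; arbitrary \<open>c\<close> is needed for the multiples of
  \<open>\<psi>\<close>.\<close>

lemma dual_surj:
  assumes f: "f \<in> carrier (dual V)" and nz: "f \<noteq> \<zero>\<^bsub>dual V\<^esub>"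
  obtains x where "x \<in> carrier V" "f x = c"
proof -
  obtain a where a: "a \<in> carrier V" "f a \<noteq> 0"
    using dual_eqI[of f V "\<zero>\<^bsub>dual V\<^esub>"] nz dual_ext[OF f] by (auto simp: dual_simps)
  then show ?thesis
    using that[of "(c / f a) \<odot> a"] dual_smult[OF f, of a] by simp
qed

lemma submodule_canon: "submodule (canon V ` carrier V) complex_ring (dual (dual V))"
proof -
  interpret D: complex_normed_space "dual V" by (rule complex_normed_space_dual)
  interpret DD: complex_normed_space "dual (dual V)" by (rule D.complex_normed_space_dual)
  show ?thesis
  proof (rule DD.submoduleI)
    show "canon V ` carrier V \<subseteq> carrier (dual (dual V))" by (auto simp: canon_closed)
    show "\<zero>\<^bsub>dual (dual V)\<^esub> \<in> canon V ` carrier V" by (auto simp: canon_zero[symmetric])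
    fix m assume "m \<in> canon V ` carrier V"
    then obtain x where x: "x \<in> carrier V" "m = canon V x" by auto
    \<comment> \<open>Writing the inverse as a scalar multiple lets linearity of
      \<open>canon\<close> handle it.\<close>
    have "\<ominus>\<^bsub>dual (dual V)\<^esub> m = (-1) \<odot>\<^bsub>dual (dual V)\<^esub> m"
      using DD.smult_l_minus[of 1 m] DD.smult_one[of m] x by (simp add: canon_closed)
    then show "\<ominus>\<^bsub>dual (dual V)\<^esub> m \<in> canon V ` carrier V"
      using x by (auto simp: canon_smult[symmetric])
    show "c \<odot>\<^bsub>dual (dual V)\<^esub> m \<in> canon V ` carrier V" for c
      using x by (auto simp: canon_smult[symmetric])
    fix n assume "n \<in> canon V ` carrier V"
    then show "m \<oplus>\<^bsub>dual (dual V)\<^esub> n \<in> canon V ` carrier V"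
      using x by (auto simp: canon_add[symmetric])
  qed
qed

end

section \<open>Module actions, Arens products and transfer along isomorphisms\<close>

context functional_product_algebra
begin

lemma act_fa_eq:
  assumes "f \<in> carrier (dual V)" "a \<in> carrier V"
  shows "act_fa V f a = \<psi> a \<odot>\<^bsub>dual V\<^esub> f"
  using assms by (auto simp: act_fa_def dual_simps mult_eq_smult dual_smult intro!: restrict_ext)

text \<open>Here \<open>f (b \<otimes> a) = \<psi> b * f a\<close>, so as a function of
  \<open>b\<close> only \<open>\<psi>\<close> survives and \<open>f\<close> enters through the
  scalar \<open>f a\<close>. In \<open>act_fa_eq\<close> the roles are opposite.\<close>

lemma act_af_eq:
  assumes "f \<in> carrier (dual V)" "a \<in> carrier V"
  shows "act_af V a f = f a \<odot>\<^bsub>dual V\<^esub> \<psi>"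
  using assms by (auto simp: act_af_def dual_simps mult_eq_smult dual_smult intro!: restrict_ext)

lemma act_nf_eq:
  assumes "n \<in> carrier (dual (dual V))" "f \<in> carrier (dual V)"
  shows "act_nf V n f = n f \<odot>\<^bsub>dual V\<^esub> \<psi>"
  \<comment> \<open>Scalar multiplication is unfolded before simplification, so the multiples later
    introduced by \<open>act_fa_eq\<close> keep the form that \<open>dual_smult\<close>
    needs.\<close>
  unfolding act_nf_def dual_simps(3)[of V]
  using assms by (auto simp: act_fa_eq dual_smult intro!: restrict_ext)

lemma act_fn_eq:
  assumes "n \<in> carrier (dual (dual V))" "f \<in> carrier (dual V)"
  shows "act_fn V f n = n \<psi> \<odot>\<^bsub>dual V\<^esub> f"
  unfolding act_fn_def dual_simps(3)[of V]
  using assms by (auto simp: act_af_eq dual_smult functional intro!: restrict_ext)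

text \<open>Linearity of \<open>m\<close> gives
  \<open>m (n f \<odot> \<psi>) = n f * m \<psi>\<close>. The other Arens product reaches the same
  value from linearity of \<open>n\<close>, as \<open>n (m \<psi> \<odot> f)\<close>.\<close>

lemma arens_box_eq:
  assumes "m \<in> carrier (dual (dual V))" "n \<in> carrier (dual (dual V))"
  shows "arens_box V m n = m \<psi> \<odot>\<^bsub>dual (dual V)\<^esub> n"
  unfolding arens_box_def dual_simps(3)[of "dual V"]
  using assms by (auto simp: act_nf_eq dual_smult functional intro!: restrict_ext)

lemma arens_diamond_eq:
  assumes "m \<in> carrier (dual (dual V))" "n \<in> carrier (dual (dual V))"
  shows "arens_diamond V m n = m \<psi> \<odot>\<^bsub>dual (dual V)\<^esub> n"
  unfolding arens_diamond_def dual_simps(3)[of "dual V"]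
  using assms by (auto simp: act_fn_eq dual_smult functional intro!: restrict_ext)

lemma arens_regular: "arens_regular V"
  by (simp add: arens_regular_def arens_box_eq arens_diamond_eq)

text \<open>The scalar \<open>m \<psi>\<close> is the value at \<open>m\<close> of the canonical
  image of \<open>\<psi>\<close>. Both products are restricted to the carrier, so the records
  themselves agree.\<close>

lemma bidual_algebra_eq: "bidual_algebra V = phi_algebra (canon (dual V) \<psi>) (dual (dual V))"
proof -
  have "(\<lambda>m\<in>carrier (dual (dual V)). \<lambda>n\<in>carrier (dual (dual V)). arens_box V m n) =
    (\<lambda>m\<in>carrier (dual (dual V)). \<lambda>n\<in>carrier (dual (dual V)).
      canon (dual V) \<psi> m \<odot>\<^bsub>dual (dual V)\<^esub> n)"
    by (auto simp: arens_box_eq canon_def intro!: restrict_ext)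
  then show ?thesis by (simp add: bidual_algebra_def phi_algebra_def)
qed

lemma bidual_mult_eq:
  assumes "m \<in> carrier (dual (dual V))" "n \<in> carrier (dual (dual V))"
  shows "m \<otimes>\<^bsub>bidual_algebra V\<^esub> n = m \<psi> \<odot>\<^bsub>dual (dual V)\<^esub> n"
  using assms by (simp add: bidual_algebra_def arens_box_eq)

lemma carrier_bidual_algebra: "carrier (bidual_algebra V) = carrier (dual (dual V))"
  by (simp add: bidual_algebra_def)

lemma bidual_functional_product_algebra:
  "functional_product_algebra (bidual_algebra V) (canon (dual V) \<psi>)"
proof (intro functional_product_algebra.intro functional_product_algebra_axioms.intro
    complex_banach_algebra_bidual_algebra)
  \<comment> \<open>\<open>dual\<close> never reads the \<open>mult\<close> field, so replacing the
    product leaves the dual unchanged.\<close>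
  have "dual (bidual_algebra V) = dual (dual (dual V))"
    by (simp add: bidual_algebra_def dual_def)
  then show "canon (dual V) \<psi> \<in> carrier (dual (bidual_algebra V))"
    using D.canon_closed[OF functional] by simp
qed (simp_all add: bidual_algebra_def arens_box_eq canon_def)

text \<open>The functional is pulled back along \<open>h\<close>. The product formula holds after
  applying \<open>h\<close>, and injectivity of \<open>h\<close> brings it back to
  \<open>W\<close>.\<close>

lemma functional_product_algebra_iso:
  assumes W: "complex_banach_algebra W" and h: "isometric_algebra_iso h W V"
  shows "functional_product_algebra W (\<lambda>x\<in>carrier W. \<psi> (h x))"
proof -
  interpret W: complex_banach_algebra W by (rule W)
  have iso: "isometric_iso h W V" and
    hm: "\<And>x y. \<lbrakk>x \<in> carrier W; y \<in> carrier W\<rbrakk> \<Longrightarrow> h (x \<otimes>\<^bsub>W\<^esub> y) = h x \<otimes>\<^bsub>V\<^esub> h y"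
    using h by (simp_all add: isometric_algebra_iso_def)
  note h' = isometric_isoD[OF iso]
  show ?thesis
  proof (intro functional_product_algebra.intro functional_product_algebra_axioms.intro W)
    show "(\<lambda>x\<in>carrier W. \<psi> (h x)) \<in> carrier (dual W)"
    proof (rule W.dualI[of _ "vnorm (dual V) \<psi>"])
      show "cmod ((\<lambda>x\<in>carrier W. \<psi> (h x)) x) \<le> vnorm (dual V) \<psi> * vnorm W x"
        if "x \<in> carrier W" for x
        using dual_bound[OF functional h'(2)] that by (simp add: h'(5))
    qed (simp_all add: h' dual_add[OF functional] dual_smult[OF functional])
    fix x y assume xy: "x \<in> carrier W" "y \<in> carrier W"
    then have "h (x \<otimes>\<^bsub>W\<^esub> y) = h (\<psi> (h x) \<odot>\<^bsub>W\<^esub> y)"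
      by (simp add: hm h' mult_eq_smult)
    moreover have "inj_on h (carrier W)" using h'(1) by (simp add: bij_betw_def)
    ultimately show "x \<otimes>\<^bsub>W\<^esub> y = (\<lambda>x\<in>carrier W. \<psi> (h x)) x \<odot>\<^bsub>W\<^esub> y"
      using xy by (simp add: inj_on_eq_iff W.mult_closed)
  qed
qed

section \<open>Products of the bidual with the canonical image\<close>

lemma bidual_mult_canon:
  assumes "\<psi> \<noteq> \<zero>\<^bsub>dual V\<^esub>"
  shows "carrier (bidual_algebra V) <#>\<^bsub>bidual_algebra V\<^esub> canon V ` carrier V = canon V ` carrier V"
proof (intro equalityI subsetI)
  fix p assume "p \<in> carrier (bidual_algebra V) <#>\<^bsub>bidual_algebra V\<^esub> canon V ` carrier V"
  then show "p \<in> canon V ` carrier V"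
    by (auto simp: set_mult_def carrier_bidual_algebra bidual_mult_eq canon_closed
        canon_smult[symmetric])
next
  fix p assume "p \<in> canon V ` carrier V"
  then obtain x where x: "x \<in> carrier V" "p = canon V x" by auto
  \<comment> \<open>Any such \<open>a\<close> is a left identity: its canonical image multiplies by
    the scalar \<open>\<psi> a = 1\<close>.\<close>
  obtain a where a: "a \<in> carrier V" "\<psi> a = 1" using dual_surj[OF functional assms] .
  have "canon V a \<otimes>\<^bsub>bidual_algebra V\<^esub> p = p"
    using x a functional smult_one[of x]
    by (simp add: bidual_mult_eq canon_closed canon_smult[symmetric])
       (simp add: canon_def)
  then show "p \<in> carrier (bidual_algebra V) <#>\<^bsub>bidual_algebra V\<^esub> canon V ` carrier V"
    using x a canon_closed unfolding set_mult_def carrier_bidual_algebra by force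
qed

lemma canon_mult_bidual:
  assumes "\<psi> \<noteq> \<zero>\<^bsub>dual V\<^esub>"
  shows "canon V ` carrier V <#>\<^bsub>bidual_algebra V\<^esub> carrier (bidual_algebra V)
    = carrier (bidual_algebra V)"
proof (intro equalityI subsetI)
  fix p assume "p \<in> canon V ` carrier V <#>\<^bsub>bidual_algebra V\<^esub> carrier (bidual_algebra V)"
  then show "p \<in> carrier (bidual_algebra V)"
    by (auto simp: set_mult_def carrier_bidual_algebra bidual_mult_eq canon_closed)
next
  fix p assume p: "p \<in> carrier (bidual_algebra V)"
  obtain a where a: "a \<in> carrier V" "\<psi> a = 1" using dual_surj[OF functional assms] .
  have "canon V a \<otimes>\<^bsub>bidual_algebra V\<^esub> p = p"
    using p a functional DD.smult_one[of p]
    by (simp add: carrier_bidual_algebra bidual_mult_eq canon_closed) (simp add: canon_def)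
  then show "p \<in> canon V ` carrier V <#>\<^bsub>bidual_algebra V\<^esub> carrier (bidual_algebra V)"
    using p a unfolding set_mult_def by force
qed

lemma left_ideal_canon: "left_ideal (canon V ` carrier V) (bidual_algebra V)"
proof -
  \<comment> \<open>Being a submodule depends only on the linear structure, which
    \<open>bidual_algebra V\<close> shares with \<open>dual (dual V)\<close>.\<close>
  have "submodule (canon V ` carrier V) complex_ring (bidual_algebra V)"
    using submodule_canon
    by (simp add: submodule_def submodule_axioms_def bidual_algebra_def subgroup_def)
  then show ?thesis
    by (auto simp: left_ideal_def carrier_bidual_algebra bidual_mult_eq canon_closed
        canon_smult[symmetric])
qed

section \<open>Products of the algebra with its dual\<close>

lemma dual_act_eq:
  assumes "\<psi> \<noteq> \<zero>\<^bsub>dual V\<^esub>"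
  shows "{act_fa V f a | f a. f \<in> carrier (dual V) \<and> a \<in> carrier V} = carrier (dual V)"
proof (intro equalityI subsetI)
  fix f assume f: "f \<in> carrier (dual V)"
  obtain a where a: "a \<in> carrier V" "\<psi> a = 1" using dual_surj[OF functional assms] .
  have "act_fa V f a = f" using f a D.smult_one[of f] by (simp add: act_fa_eq)
  then show "f \<in> {act_fa V f a | f a. f \<in> carrier (dual V) \<and> a \<in> carrier V}"
    using f a by force
qed (auto simp: act_fa_closed)

lemma act_dual_eq:
  assumes "\<psi> \<noteq> \<zero>\<^bsub>dual V\<^esub>"
  shows "{act_af V a f | a f. a \<in> carrier V \<and> f \<in> carrier (dual V)}
    = {c \<odot>\<^bsub>dual V\<^esub> \<psi> | c :: complex. True}"
proof (intro equalityI subsetI)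
  fix g assume "g \<in> {c \<odot>\<^bsub>dual V\<^esub> \<psi> | c :: complex. True}"
  then obtain c where g: "g = c \<odot>\<^bsub>dual V\<^esub> \<psi>" by auto
  \<comment> \<open>Acting on \<open>\<psi>\<close> itself suffices: \<open>a\<close> sends it to
    \<open>\<psi> a \<odot> \<psi>\<close>, and \<open>\<psi> a\<close> can be any complex
    number.\<close>
  obtain a where a: "a \<in> carrier V" "\<psi> a = c" using dual_surj[OF functional assms] .
  show "g \<in> {act_af V a f | a f. a \<in> carrier V \<and> f \<in> carrier (dual V)}"
    using g a functional act_af_eq[OF functional a(1)] by force
qed (auto simp: act_af_eq)

end

section \<open>Even duals and the conclusion for \<open>phi_algebra\<close>\<close>

lemma even_dual_functional_product_algebra:
  assumes "even_dual B n C" and "functional_product_algebra B \<phi>"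
  shows "\<exists>\<psi>. functional_product_algebra C \<psi>"
  using assms(1)
proof (induction rule: even_dual.induct)
  case (zero C h)
  then show ?case
    using functional_product_algebra.functional_product_algebra_iso[OF assms(2)] by blast
next
  \<comment> \<open>The functional changes at each stage, hence the existential:
    \<open>\<psi>\<close> on \<open>C\<close> becomes its canonical image on
    \<open>bidual_algebra C\<close>, then the pullback of that along \<open>h\<close> on
    \<open>D\<close>.\<close>
  case (Suc n C D h)
  then show ?case
    using functional_product_algebra.functional_product_algebra_iso
      functional_product_algebra.bidual_functional_product_algebra by blast
qed

lemma dual_phi_algebra: "dual (phi_algebra \<phi> A) = dual A"
  by (simp add: phi_algebra_def dual_def)

lemma functional_product_algebra_phi_algebra:
  assumes "complex_banach_space A" "\<phi> \<in> carrier (dual A)" "vnorm (dual A) \<phi> \<le> 1"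
  shows "functional_product_algebra (phi_algebra \<phi> A) \<phi>"
proof (intro functional_product_algebra.intro functional_product_algebra_axioms.intro
    complex_banach_algebra_phi_algebra assms)
qed (simp_all add: dual_phi_algebra assms, simp_all add: phi_algebra_def)

theorem proposition1:
  fixes A B :: "'a normed_module"
    and \<phi> :: "'a \<Rightarrow> complex"
  assumes "complex_banach_space A"
    and "\<phi> \<in> carrier (dual A)"
    and "\<phi> \<noteq> \<zero>\<^bsub>dual A\<^esub>"
    and "vnorm (dual A) \<phi> \<le> 1"
    and "B = phi_algebra \<phi> A"
  shows
    \<comment> \<open>(i)\<close>
    "arens_regular B \<and>
     bidual_algebra B = phi_algebra (canon (dual A) \<phi>) (dual (dual A)) \<and>
     (\<forall>n. \<forall>C :: 'u normed_module. even_dual B n C \<longrightarrow> arens_regular C) \<and>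
     \<comment> \<open>(ii)\<close>
     carrier (bidual_algebra B) <#>\<^bsub>bidual_algebra B\<^esub> canon B ` carrier B
       = canon B ` carrier B \<and>
     canon B ` carrier B <#>\<^bsub>bidual_algebra B\<^esub> carrier (bidual_algebra B)
       = carrier (bidual_algebra B) \<and>
     left_ideal (canon B ` carrier B) (bidual_algebra B) \<and>
     \<comment> \<open>(iii)\<close>
     {act_fa B f a | f a. f \<in> carrier (dual B) \<and> a \<in> carrier B} = carrier (dual B) \<and>
     {act_af B a f | a f. a \<in> carrier B \<and> f \<in> carrier (dual B)}
       = {c \<odot>\<^bsub>dual B\<^esub> \<phi> | c :: complex. True}"
proof -
  interpret B: functional_product_algebra B \<phi>
    using functional_product_algebra_phi_algebra assms by blast
  have dual: "dual B = dual A" by (simp add: assms dual_phi_algebra)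
  then have nz: "\<phi> \<noteq> \<zero>\<^bsub>dual B\<^esub>" using assms by simp
  have "bidual_algebra B = phi_algebra (canon (dual A) \<phi>) (dual (dual A))"
    using B.bidual_algebra_eq by (simp add: dual)
  moreover have "\<forall>n. \<forall>C :: 'u normed_module. even_dual B n C \<longrightarrow> arens_regular C"
    using even_dual_functional_product_algebra[OF _ B.functional_product_algebra_axioms]
      functional_product_algebra.arens_regular by blast
  ultimately show ?thesis
    by (intro conjI B.arens_regular B.bidual_mult_canon[OF nz] B.canon_mult_bidual[OF nz]
        B.left_ideal_canon B.dual_act_eq[OF nz] B.act_dual_eq[OF nz])
qed

end
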